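(* Let $\mu\geq 1$, $u\geq 1$, $x\geq 3$ and $\ell_1,\ldots,\ell_u\geq 3$ be integers, and let $w\geq 1$, $\epsilon\in\{1,2\}$ with $x+\mu\sum_{i=1}^u\ell_i=2w+\epsilon$. If $OP(x,{}^{\mu}\ell_1,\ldots,{}^{\mu}\ell_u)$ (of order $2w+\epsilon$) has a solution, then $OP(y,\ell_1,\ldots,\ell_u)$ has a solution, where $y=2w\mu+\epsilon-\sum_{i=1}^u\ell_i$.
   Context: $K_v^*$ is $K_v$ for $v$ odd and $K_v$ minus a $1$-factor for $v$ even. A solution to $OP(F)$, $F$ a $2$-regular graph of order $v$, is a decomposition of $E(K_v^* )$ into spanning subgraphs isomorphic to $F$. $OP(m_1,\ldots,m_s)$ denotes $OP(F)$ with $F$ $2$-regular with cycle lengths $m_1,\ldots,m_s$; $OP(x,{}^{\mu}\ell_1,\ldots,{}^{\mu}\ell_u)$ denotes the case of one $x$-cycle and $\mu$ cycles of length $\ell_i$ for each $i$. *)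

theory Defs
  imports Main "HOL-Library.Multiset"
begin

definition complete_edges :: "nat \<Rightarrow> nat set set" where
  "complete_edges v = {e. \<exists>a b. a < v \<and> b < v \<and> a \<noteq> b \<and> e = {a, b}}"

definition one_factor :: "nat \<Rightarrow> nat set set \<Rightarrow> bool" where
  "one_factor v I \<longleftrightarrow> I \<subseteq> complete_edges v \<and>
     (\<forall>a<v. \<exists>!e. e \<in> I \<and> a \<in> e)"

definition cycle_edges :: "nat list \<Rightarrow> nat set set" where
  "cycle_edges c = {{c ! i, c ! ((i + 1) mod length c)} | i. i < length c}"

definition two_factor_of_type :: "nat \<Rightarrow> nat multiset \<Rightarrow> nat set set \<Rightarrow> bool" where
  "two_factor_of_type v M H \<longleftrightarrow>
     (\<exists>cs :: nat list list.
        mset (map length cs) = M \<and>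
        (\<forall>c \<in> set cs. length c \<ge> 3) \<and>
        distinct (concat cs) \<and> set (concat cs) = {0..<v} \<and>
        H = (\<Union>c \<in> set cs. cycle_edges c))"

text \<open>E(K_v^*): K_v for v odd, K_v minus a 1-factor for v even.  Since all
  1-factors of K_v are equivalent under automorphisms, we may take any one.\<close>
definition OP_solvable :: "nat multiset \<Rightarrow> bool" where
  "OP_solvable M \<longleftrightarrow>
     (let v = sum_mset M in
      \<exists>I D. (if even v then one_factor v I else I = {}) \<and>
            (\<forall>A\<in>D. \<forall>B\<in>D. A \<noteq> B \<longrightarrow> A \<inter> B = {}) \<and>
            \<Union>D = complete_edges v - I \<and>
            (\<forall>H\<in>D. two_factor_of_type v M H))"

end

theory Submission
  imports Defs "HOL-Library.Disjoint_Sets"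
begin

text \<open>
  The given solution of order \<open>v = 2w + \<epsilon>\<close> consists of \<open>w\<close> 2-factors, each with one \<open>x\<close>-cycle and \<open>\<mu>\<close> copies
  of the cycles of lengths \<open>\<ell>\<^sub>1, \<dots>, \<ell>\<^sub>u\<close>. Give every copy its own colour, and split the edges of the \<open>x\<close>-cycle
  between two of the \<open>\<mu>\<close> colours of its factor. This colours \<open>K\<^sub>v\<close> (without its 1-factor when \<open>v\<close> is even) with
  \<open>w\<mu>\<close> colours such that each class consists of one copy of the small cycles and a linear forest on the remaining
  vertices. As in Hilton's theorem on embedding edge-coloured complete graphs into Hamiltonian decompositions,
  vertices are added one at a time until the order is \<open>2w\<mu> + \<epsilon>\<close>, and the last one closes all the forests
  to cycles. While \<open>m\<close> vertices are still missing, no forest has more than \<open>m\<close> paths, and every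
  vertex has exactly \<open>m\<close> free path ends over all colours (the unmatched vertices of the 1-factor counting once).
  The edges at a new vertex correspond to a choice of one free end at every old vertex; the choice has to be
  fair, i.e. it contains about a fraction \<open>1/m\<close> of the free ends of each path and of each colour. Such a choice is
  a class of an equitable colouring of the free ends with \<open>m\<close> colours.
\<close>

section \<open>Equitable colourings and fair selections\<close>

text \<open>Edges from \<open>x\<close> to \<open>s x\<close> and to \<open>t x\<close> form a graph
  whose components are paths or cycles alternating between the two kinds; such cycles are even, so
  the graph is bipartite. The induction deletes one pair at a time instead of treating whole
  components.\<close>

lemma two_involutions_bool:
  assumes "finite T"
    and "\<And>x. x \<in> T \<Longrightarrow> s x \<in> T \<and> s (s x) = x"
    and "\<And>x. x \<in> T \<Longrightarrow> t x \<in> T \<and> t (t x) = x"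
  shows "\<exists>f :: 'a \<Rightarrow> bool. \<forall>x\<in>T. (s x \<noteq> x \<longrightarrow> f (s x) \<noteq> f x) \<and> (t x \<noteq> x \<longrightarrow> f (t x) \<noteq> f x)"
  using assms
proof (induction "card T" arbitrary: T s t rule: less_induct)
  case less
  \<comment> \<open>Formulated for arbitrary \<open>s\<close> and \<open>t\<close>, so that it
    applies with their roles exchanged once \<open>s\<close> has only fixed points.\<close>
  have reduce: "\<exists>f :: 'a \<Rightarrow> bool. \<forall>x\<in>T. (s x \<noteq> x \<longrightarrow> f (s x) \<noteq> f x) \<and> (t x \<noteq> x \<longrightarrow> f (t x) \<noteq> f x)"
    if s: "\<And>x. x \<in> T \<Longrightarrow> s x \<in> T \<and> s (s x) = x"
      and t: "\<And>x. x \<in> T \<Longrightarrow> t x \<in> T \<and> t (t x) = x"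
      and x: "x \<in> T" "s x \<noteq> x" for s t :: "'a \<Rightarrow> 'a" and x
  proof -
    define y where "y = s x"
    have y: "y \<in> T" "y \<noteq> x" "s y = x" using s[OF x(1)] x y_def by auto
    \<comment> \<open>Contracts the path \<open>t x, x, y, t y\<close> to a single edge: the
      partners orphaned by deleting \<open>x\<close> and \<open>y\<close> are paired with each
      other, and a lone orphan becomes a fixed point.\<close>
    define t' where "t' = (\<lambda>z. if z = t x then (if t y = y then z else t y)
      else if z = t y then (if t x = x then z else t x) else t z)"
    let ?T = "T - {x, y}"
    have c: "card ?T < card T" using x less.prems(1) by (intro psubset_card_mono) auto
    have s': "s z \<in> ?T \<and> s (s z) = z" if "z \<in> ?T" for z
    proof -
      have z: "z \<in> T" "z \<noteq> x" "z \<noteq> y" using that by auto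
      have "s z \<noteq> x" using s[OF z(1)] z(3) y_def by auto
      moreover have "s z \<noteq> y" using s[OF z(1)] z(2) y(3) by auto
      ultimately show ?thesis using s[OF z(1)] by auto
    qed
    have t': "t' z \<in> ?T \<and> t' (t' z) = z" if "z \<in> ?T" for z
    proof -
      have z: "z \<in> T" "z \<noteq> x" "z \<noteq> y" using that by auto
      have ne: "t x \<noteq> t y" using t[OF x(1)] t[OF y(1)] y(2) by metis
      consider "z = t x" | "z \<noteq> t x" "z = t y" | "z \<noteq> t x" "z \<noteq> t y" by blast
      then show ?thesis
      proof cases
        case 1
        moreover have "t y \<noteq> x" using t[OF y(1)] z 1 by metis
        ultimately show ?thesis using z ne t[OF y(1)] by (auto simp: t'_def)
      next
        case 2
        moreover have "t x \<noteq> y" using t[OF x(1)] z 2 by metis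
        ultimately show ?thesis using z ne t[OF x(1)] by (auto simp: t'_def)
      next
        case 3
        then have "t z \<noteq> x" "t z \<noteq> y" "t z \<noteq> t x" "t z \<noteq> t y"
          using t[OF z(1)] t[OF x(1)] t[OF y(1)] z by metis+
        then show ?thesis using 3 t[OF z(1)] by (auto simp: t'_def)
      qed
    qed
    have "\<exists>f :: 'a \<Rightarrow> bool. \<forall>z\<in>?T. (s z \<noteq> z \<longrightarrow> f (s z) \<noteq> f z) \<and> (t' z \<noteq> z \<longrightarrow> f (t' z) \<noteq> f z)"
      by (rule less.hyps[OF c]) (simp add: less.prems(1), erule s', erule t')
    then obtain f :: "'a \<Rightarrow> bool" where f: "\<forall>z\<in>?T. (s z \<noteq> z \<longrightarrow> f (s z) \<noteq> f z) \<and> (t' z \<noteq> z \<longrightarrow> f (t' z) \<noteq> f z)" by blast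
    \<comment> \<open>By \<open>link\<close> the endpoints of a contracted edge have different
      values, so one alternating choice on \<open>x\<close> and \<open>y\<close> suits both of
      them.\<close>
    define fx where "fx = (if t x \<in> ?T then \<not> f (t x) else if t y \<in> ?T then f (t y) else True)"
    define g where "g = f(x := fx, y := \<not> fx)"
    have g: "g z = f z" if "z \<in> ?T" for z using that by (auto simp: g_def)
    have gx: "g x = fx" "g y = (\<not> fx)" using y by (auto simp: g_def)
    have link: "f (t x) \<noteq> f (t y)" if "t x \<in> ?T" "t y \<in> ?T"
    proof -
      have "t x \<noteq> t y" using t[OF x(1)] t[OF y(1)] y(2) by metis
      moreover have "t y \<noteq> y" using that by auto
      ultimately show ?thesis using f that unfolding t'_def by metis
    qed
    have "(s z \<noteq> z \<longrightarrow> g (s z) \<noteq> g z) \<and> (t z \<noteq> z \<longrightarrow> g (t z) \<noteq> g z)" if z: "z \<in> T" for z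
    proof (rule conjI)
      show "s z \<noteq> z \<longrightarrow> g (s z) \<noteq> g z"
      proof (cases "z \<in> ?T")
        case True
        then show ?thesis using s'[OF True] f g by metis
      next
        case False
        then show ?thesis using z gx y y_def by auto
      qed
      have tx: "t x \<noteq> x \<longrightarrow> g (t x) \<noteq> g x"
        using gx g[of "t x"] t[OF x(1)] unfolding fx_def by (cases "t x = y") auto
      have ty: "t y \<noteq> y \<longrightarrow> g (t y) \<noteq> g y"
        using gx g[of "t y"] t[OF y(1)] link unfolding fx_def
        by (cases "t y = x") (auto split: if_splits)
      show "t z \<noteq> z \<longrightarrow> g (t z) \<noteq> g z"
      proof (cases "z \<in> ?T \<and> t z \<in> ?T")
        case True
        then have "z \<noteq> t x" "z \<noteq> t y" using t[OF x(1)] t[OF y(1)] by auto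
        then have "t' z = t z" unfolding t'_def by auto
        then show ?thesis using True f g by metis
      next
        case False
        then have "z = x \<or> z = y \<or> t z = x \<or> t z = y" using z t[OF z] by auto
        then show ?thesis using tx ty t[OF z] by metis
      qed
    qed
    then show ?thesis by blast
  qed
  show ?case
  proof (cases "\<exists>x\<in>T. s x \<noteq> x")
    case True
    then obtain x where x: "x \<in> T" "s x \<noteq> x" by blast
    show ?thesis by (rule reduce[OF less.prems(2) less.prems(3) x])
  next
    case s_id: False
    show ?thesis
    proof (cases "\<exists>x\<in>T. t x \<noteq> x")
      case True
      then obtain x where x: "x \<in> T" "t x \<noteq> x" by blast
      have "\<exists>f :: 'a \<Rightarrow> bool. \<forall>x\<in>T. (t x \<noteq> x \<longrightarrow> f (t x) \<noteq> f x) \<and> (s x \<noteq> x \<longrightarrow> f (s x) \<noteq> f x)"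
        by (rule reduce[OF less.prems(3) less.prems(2) x])
      then show ?thesis by (simp only: conj_commute)
    next
      case False
      then show ?thesis using s_id by blast
    qed
  qed
qed

text \<open>Pairs from a common fibre are split off until \<open>g\<close> is injective on the rest.
  That rest is the set of fixed points, so no fibre keeps more than one.\<close>

lemma pairing_of_fibres:
  assumes "finite T"
  shows "\<exists>s. (\<forall>x\<in>T. s x \<in> T \<and> s (s x) = x \<and> g (s x) = g x) \<and>
    (\<forall>x\<in>T. \<forall>y\<in>T. s x = x \<longrightarrow> s y = y \<longrightarrow> g x = g y \<longrightarrow> x = y)"
  using assms
proof (induction "card T" arbitrary: T rule: less_induct)
  case less
  show ?case
  proof (cases "inj_on g T")
    case True
    then show ?thesis by (intro exI[of _ "\<lambda>x. x"]) (auto dest: inj_onD)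
  next
    case False
    then obtain x y where xy: "x \<in> T" "y \<in> T" "x \<noteq> y" "g x = g y" by (auto simp: inj_on_def)
    let ?T = "T - {x, y}"
    have c: "card ?T < card T" using xy less.prems by (intro psubset_card_mono) auto
    obtain s where s: "\<forall>z\<in>?T. s z \<in> ?T \<and> s (s z) = z \<and> g (s z) = g z"
      "\<forall>z\<in>?T. \<forall>z'\<in>?T. s z = z \<longrightarrow> s z' = z' \<longrightarrow> g z = g z' \<longrightarrow> z = z'"
      using less.hyps[OF c finite_Diff[OF less.prems]] by blast
    show ?thesis
    proof (intro exI[of _ "s(x := y, y := x)"] conjI ballI impI)
      fix z assume "z \<in> T"
      have in_T: "s z \<in> ?T" "s (s z) = z" "g (s z) = g z" if "z \<in> ?T" using s(1) that by blast+
      have "(s(x := y, y := x)) z \<in> T \<and> (s(x := y, y := x)) ((s(x := y, y := x)) z) = z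
        \<and> g ((s(x := y, y := x)) z) = g z"
      proof (cases "z \<in> ?T")
        case True
        then show ?thesis using in_T[OF True] by simp
      next
        case False
        then show ?thesis using xy \<open>z \<in> T\<close> by auto
      qed
      then show "(s(x := y, y := x)) z \<in> T" "(s(x := y, y := x)) ((s(x := y, y := x)) z) = z"
        "g ((s(x := y, y := x)) z) = g z" by blast+
    next
      fix z z' assume a: "z \<in> T" "z' \<in> T" "(s(x := y, y := x)) z = z" "(s(x := y, y := x)) z' = z'" "g z = g z'"
      have z: "z \<in> ?T" "z' \<in> ?T" using a(1-4) xy(3) by (auto split: if_splits)
      then have "s z = z" "s z' = z'" using a(3,4) by auto
      then show "z = z'" using z a(5) s(2) by blast
    qed
  qed
qed

text \<open>Apart from at most one fixed point, \<open>s\<close> is a bijection between the true and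
  the false elements of \<open>X\<close>.\<close>

lemma card_balanced_of_involution:
  assumes "finite X" and "\<And>x. x \<in> X \<Longrightarrow> s x \<noteq> x \<Longrightarrow> s x \<in> X \<and> s (s x) = x \<and> f (s x) \<noteq> f x"
    and "\<And>x y. x \<in> X \<Longrightarrow> y \<in> X \<Longrightarrow> s x = x \<Longrightarrow> s y = y \<Longrightarrow> x = y"
  shows "card {x \<in> X. f x} \<le> card {x \<in> X. \<not> f x} + 1 \<and> card {x \<in> X. \<not> f x} \<le> card {x \<in> X. f x} + 1"
proof -
  let ?Z = "{x \<in> X. s x = x}"
  have Z: "card ?Z \<le> 1" using assms(3) by (intro card_le_Suc0_iff_eq[THEN iffD2, unfolded One_nat_def[symmetric]]) (auto simp: assms(1))
  have "bij_betw s {x \<in> X. f x \<and> s x \<noteq> x} {x \<in> X. \<not> f x \<and> s x \<noteq> x}"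
  proof (rule bij_betw_byWitness[where f' = s])
    show "\<forall>x\<in>{x \<in> X. f x \<and> s x \<noteq> x}. s (s x) = x" "\<forall>x\<in>{x \<in> X. \<not> f x \<and> s x \<noteq> x}. s (s x) = x"
      using assms(2) by blast+
    show "s ` {x \<in> X. f x \<and> s x \<noteq> x} \<subseteq> {x \<in> X. \<not> f x \<and> s x \<noteq> x}"
      "s ` {x \<in> X. \<not> f x \<and> s x \<noteq> x} \<subseteq> {x \<in> X. f x \<and> s x \<noteq> x}"
      using assms(2) by fastforce+
  qed
  then have e: "card {x \<in> X. f x \<and> s x \<noteq> x} = card {x \<in> X. \<not> f x \<and> s x \<noteq> x}" by (rule bij_betw_same_card)
  have 1: "card {x \<in> X. f x} \<le> card {x \<in> X. f x \<and> s x \<noteq> x} + card ?Z"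
    by (rule order_trans[OF card_mono card_Un_le]) (auto simp: assms(1))
  have 2: "card {x \<in> X. \<not> f x} \<le> card {x \<in> X. \<not> f x \<and> s x \<noteq> x} + card ?Z"
    by (rule order_trans[OF card_mono card_Un_le]) (auto simp: assms(1))
  have 3: "card {x \<in> X. f x \<and> s x \<noteq> x} \<le> card {x \<in> X. f x}" "card {x \<in> X. \<not> f x \<and> s x \<noteq> x} \<le> card {x \<in> X. \<not> f x}"
    by (auto intro!: card_mono simp: assms(1))
  show ?thesis using 1 2 3 e Z by linarith
qed

definition split_evenly :: "'a set \<Rightarrow> ('a \<Rightarrow> bool) \<Rightarrow> bool" where
  "split_evenly X f \<longleftrightarrow> card {x \<in> X. f x} \<le> card {x \<in> X. \<not> f x} + 1 \<and> card {x \<in> X. \<not> f x} \<le> card {x \<in> X. f x} + 1"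

text \<open>Elements are paired inside the fibres of \<open>g1\<close>, then the leftovers inside
  the coarser fibres of \<open>g2\<close>; the result is one involution serving both partitions. The
  fibres of \<open>g3\<close> supply a second involution, and a two-colouring can alternate along
  both.\<close>

lemma even_split_of_fibres:
  fixes T :: "'a set"
  assumes "finite T" and refines: "\<And>x y. g1 x = g1 y \<Longrightarrow> g2 x = g2 y"
  shows "\<exists>f. (\<forall>z. split_evenly {x \<in> T. g1 x = z} f) \<and> (\<forall>z. split_evenly {x \<in> T. g2 x = z} f) \<and> (\<forall>z. split_evenly {x \<in> T. g3 x = z} f)"
proof -
  obtain s1 where s1: "\<forall>x\<in>T. s1 x \<in> T \<and> s1 (s1 x) = x \<and> g1 (s1 x) = g1 x"
    "\<forall>x\<in>T. \<forall>y\<in>T. s1 x = x \<longrightarrow> s1 y = y \<longrightarrow> g1 x = g1 y \<longrightarrow> x = y"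
    using pairing_of_fibres[OF assms(1), of g1] by blast
  define T2 where "T2 = {x \<in> T. s1 x = x}"
  have T2: "finite T2" using assms(1) by (simp add: T2_def)
  obtain s2 where s2: "\<forall>x\<in>T2. s2 x \<in> T2 \<and> s2 (s2 x) = x \<and> g2 (s2 x) = g2 x"
    "\<forall>x\<in>T2. \<forall>y\<in>T2. s2 x = x \<longrightarrow> s2 y = y \<longrightarrow> g2 x = g2 y \<longrightarrow> x = y"
    using pairing_of_fibres[OF T2, of g2] by blast
  obtain t where t: "\<forall>x\<in>T. t x \<in> T \<and> t (t x) = x \<and> g3 (t x) = g3 x"
    "\<forall>x\<in>T. \<forall>y\<in>T. t x = x \<longrightarrow> t y = y \<longrightarrow> g3 x = g3 y \<longrightarrow> x = y"
    using pairing_of_fibres[OF assms(1), of g3] by blast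
  define s where "s x = (if x \<in> T2 then s2 x else s1 x)" for x
  have s1_out: "s1 x \<in> T - T2" if "x \<in> T - T2" for x
    using that s1(1) by (auto simp: T2_def)
  have s: "s x \<in> T \<and> s (s x) = x \<and> g2 (s x) = g2 x" if "x \<in> T" for x
  proof (cases "x \<in> T2")
    case True
    then show ?thesis using s2(1) by (auto simp: s_def T2_def)
  next
    case False
    then have "s1 x \<in> T" "s1 x \<notin> T2" "s1 (s1 x) = x" "g1 (s1 x) = g1 x" using s1_out[of x] s1(1) that by blast+
    then show ?thesis using False refines[of "s1 x" x] by (simp add: s_def)
  qed
  have "\<exists>f :: 'a \<Rightarrow> bool. \<forall>x\<in>T. (s x \<noteq> x \<longrightarrow> f (s x) \<noteq> f x) \<and> (t x \<noteq> x \<longrightarrow> f (t x) \<noteq> f x)"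
    by (rule two_involutions_bool) (use assms(1) s t(1) in blast)+
  then obtain f :: "'a \<Rightarrow> bool" where f: "\<forall>x\<in>T. (s x \<noteq> x \<longrightarrow> f (s x) \<noteq> f x) \<and> (t x \<noteq> x \<longrightarrow> f (t x) \<noteq> f x)" by blast
  have f1: "f (s1 x) \<noteq> f x" if "x \<in> T" "s1 x \<noteq> x" for x
  proof -
    have "x \<notin> T2" using that by (auto simp: T2_def)
    then have "s x = s1 x" by (simp add: s_def)
    then show ?thesis using f that by metis
  qed
  have "split_evenly {x \<in> T. g1 x = z} f" for z
    unfolding split_evenly_def
  proof (rule card_balanced_of_involution[where s = s1])
    show "finite {x \<in> T. g1 x = z}" using assms(1) by simp
    show "s1 x \<in> {x \<in> T. g1 x = z} \<and> s1 (s1 x) = x \<and> f (s1 x) \<noteq> f x" if "x \<in> {x \<in> T. g1 x = z}" "s1 x \<noteq> x" for x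
      using that s1(1) f1 by blast
  qed (use s1(2) in blast)
  moreover have "split_evenly {x \<in> T. g2 x = z} f" for z
    unfolding split_evenly_def
  proof (rule card_balanced_of_involution[where s = s])
    show "finite {x \<in> T. g2 x = z}" using assms(1) by simp
    show "s x \<in> {x \<in> T. g2 x = z} \<and> s (s x) = x \<and> f (s x) \<noteq> f x" if "x \<in> {x \<in> T. g2 x = z}" "s x \<noteq> x" for x
      using that s f by blast
    fix x y assume xy: "x \<in> {x \<in> T. g2 x = z}" "y \<in> {x \<in> T. g2 x = z}" "s x = x" "s y = y"
    \<comment> \<open>A fixed point of \<open>s\<close> stayed single in both rounds of pairing, so
      it is the only leftover of its \<open>g2\<close>-fibre.\<close>
    have "x' \<in> T2" if "x' \<in> T" "s x' = x'" for x' using that by (auto simp: s_def T2_def split: if_splits)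
    then have "x \<in> T2" "y \<in> T2" using xy by blast+
    moreover have "s2 x = x" "s2 y = y" using calculation xy(3,4) by (simp_all add: s_def)
    ultimately show "x = y" using s2(2) xy(1,2) by blast
  qed
  moreover have "split_evenly {x \<in> T. g3 x = z} f" for z
    unfolding split_evenly_def
  proof (rule card_balanced_of_involution[where s = t])
    show "finite {x \<in> T. g3 x = z}" using assms(1) by simp
    show "t x \<in> {x \<in> T. g3 x = z} \<and> t (t x) = x \<and> f (t x) \<noteq> f x" if "x \<in> {x \<in> T. g3 x = z}" "t x \<noteq> x" for x
      using that t(1) f by blast
  qed (use t(2) in blast)
  ultimately show ?thesis by blast
qed

section \<open>Equitable colourings with \<open>m\<close> colours\<close>

text \<open>For a fixed sum, the sum of squares grows with the absolute difference. The parity of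
  that difference is fixed too, so a difference of at most one is the least possible.\<close>

lemma sum_squares_even_split:
  fixes a b a' b' :: nat
  assumes "a + b = a' + b'" and "a' \<le> b' + 1" and "b' \<le> a' + 1"
  shows "a'\<^sup>2 + b'\<^sup>2 \<le> a\<^sup>2 + b\<^sup>2" and "b + 1 < a \<Longrightarrow> a'\<^sup>2 + b'\<^sup>2 < a\<^sup>2 + b\<^sup>2"
proof -
  define d d' :: int where "d = int a - int b" and "d' = int a' - int b'"
  have eq: "int a + int b = int a' + int b'" using assms(1) by linarith
  have i: "2 * (int p ^ 2 + int q ^ 2) = (int p + int q)\<^sup>2 + (int p - int q)\<^sup>2" for p q
    by (simp add: power2_eq_square algebra_simps)
  have par: "d mod 2 = d' mod 2" using eq unfolding d_def d'_def by presburger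
  have "\<bar>d'\<bar> \<le> 1" using assms by (auto simp: d'_def)
  moreover have "\<bar>d'\<bar> \<le> \<bar>d\<bar>" using calculation par by presburger
  then have "d'\<^sup>2 \<le> d\<^sup>2" by (metis abs_le_square_iff)
  then have "int a' ^ 2 + int b' ^ 2 \<le> int a ^ 2 + int b ^ 2"
    using i[of a b] i[of a' b'] eq by (simp add: d_def d'_def)
  then show "a'\<^sup>2 + b'\<^sup>2 \<le> a\<^sup>2 + b\<^sup>2" by (metis of_nat_add of_nat_le_iff of_nat_power)
  assume "b + 1 < a"
  then have "\<bar>d'\<bar> < \<bar>d\<bar>" using \<open>\<bar>d'\<bar> \<le> 1\<close> by (simp add: d_def)
  then have "d'\<^sup>2 < d\<^sup>2" by (metis abs_le_square_iff linorder_not_less)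
  then have "int a' ^ 2 + int b' ^ 2 < int a ^ 2 + int b ^ 2"
    using i[of a b] i[of a' b'] eq by (simp add: d_def d'_def)
  then show "a'\<^sup>2 + b'\<^sup>2 < a\<^sup>2 + b\<^sup>2" by (metis of_nat_add of_nat_less_iff of_nat_power)
qed

text \<open>Take a colouring minimising the sum of squared class sizes: re-splitting the union of two
  classes evenly cannot decrease that sum.\<close>

lemma equitable_colouring:
  fixes E :: "'a set" and m :: nat
  assumes "finite E" and "\<And>X. X \<in> F \<Longrightarrow> X \<subseteq> E" and "m > 0"
    and split: "\<And>T. T \<subseteq> E \<Longrightarrow> \<exists>f. \<forall>X\<in>F. split_evenly (X \<inter> T) f"
  shows "\<exists>h. (\<forall>e\<in>E. h e < m) \<and>
    (\<forall>X\<in>F. \<forall>j<m. \<forall>k<m. card {e \<in> X. h e = j} \<le> card {e \<in> X. h e = k} + 1)"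
proof -
  have finF: "finite F" using assms(1,2) by (meson Pow_iff finite_Pow_iff finite_subset subsetI)
  define pot where "pot h = (\<Sum>X\<in>F. \<Sum>j<m. (card {e \<in> X. h e = j})\<^sup>2)" for h :: "'a \<Rightarrow> nat"
  obtain h where h: "\<forall>e\<in>E. h e < m" and min: "\<And>h'. \<forall>e\<in>E. h' e < m \<Longrightarrow> pot h \<le> pot h'"
    using ex_has_least_nat[of "\<lambda>h. \<forall>e\<in>E. h e < m" "\<lambda>_. 0" pot] assms(3) by auto
  have "card {e \<in> X. h e = j} \<le> card {e \<in> X. h e = k} + 1" if X: "X \<in> F" and jk: "j < m" "k < m" for X j k
  proof (rule ccontr)
    assume bad: "\<not> card {e \<in> X. h e = j} \<le> card {e \<in> X. h e = k} + 1"
    then have "j \<noteq> k" by auto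
    define T where "T = {e \<in> E. h e = j \<or> h e = k}"
    obtain f where f: "\<forall>X\<in>F. split_evenly (X \<inter> T) f" using split[of T] by (auto simp: T_def)
    define h' where "h' e = (if e \<in> T then if f e then j else k else h e)" for e
    have h': "\<forall>e\<in>E. h' e < m" using h jk by (auto simp: h'_def)
    have decomp: "(\<Sum>i<m. (card {e \<in> Y. g e = i})\<^sup>2) =
        (card {e \<in> Y. g e = j})\<^sup>2 + (card {e \<in> Y. g e = k})\<^sup>2 + (\<Sum>i\<in>{..<m}-{j,k}. (card {e \<in> Y. g e = i})\<^sup>2)"
      for Y and g :: "'a \<Rightarrow> nat"
    proof -
      have "{..<m} - {j} - {k} = {..<m} - {j, k}" by auto
      then show ?thesis
        using sum.remove[of "{..<m}" j "\<lambda>i. (card {e \<in> Y. g e = i})\<^sup>2"] sum.remove[of "{..<m} - {j}" k "\<lambda>i. (card {e \<in> Y. g e = i})\<^sup>2"]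
          jk \<open>j \<noteq> k\<close> by simp
    qed
    have rest: "(\<Sum>i\<in>{..<m}-{j,k}. (card {e \<in> Y. h' e = i})\<^sup>2) = (\<Sum>i\<in>{..<m}-{j,k}. (card {e \<in> Y. h e = i})\<^sup>2)"
      if "Y \<in> F" for Y
    proof (rule sum.cong)
      fix i assume "i \<in> {..<m}-{j,k}"
      then have "{e \<in> Y. h' e = i} = {e \<in> Y. h e = i}" by (auto simp: h'_def T_def)
      then show "(card {e \<in> Y. h' e = i})\<^sup>2 = (card {e \<in> Y. h e = i})\<^sup>2" by simp
    qed simp
    have two: "card {e \<in> Y. h e = j} + card {e \<in> Y. h e = k} = card {e \<in> Y. h' e = j} + card {e \<in> Y. h' e = k}"
      "card {e \<in> Y. h' e = j} \<le> card {e \<in> Y. h' e = k} + 1" "card {e \<in> Y. h' e = k} \<le> card {e \<in> Y. h' e = j} + 1"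
      if "Y \<in> F" for Y
    proof -
      have Y: "Y \<subseteq> E" "finite Y" using that assms(1,2) by (auto intro: finite_subset)
      have j: "{e \<in> Y. h' e = j} = {e \<in> Y \<inter> T. f e}" and k: "{e \<in> Y. h' e = k} = {e \<in> Y \<inter> T. \<not> f e}"
        using \<open>j \<noteq> k\<close> Y by (auto simp: h'_def T_def)
      show "card {e \<in> Y. h' e = j} \<le> card {e \<in> Y. h' e = k} + 1" "card {e \<in> Y. h' e = k} \<le> card {e \<in> Y. h' e = j} + 1"
        using f that unfolding j k split_evenly_def by auto
      have "card {e \<in> Y. h e = j} + card {e \<in> Y. h e = k} = card ({e \<in> Y. h e = j} \<union> {e \<in> Y. h e = k})"
        using Y \<open>j \<noteq> k\<close> by (subst card_Un_disjoint) auto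
      also have "{e \<in> Y. h e = j} \<union> {e \<in> Y. h e = k} = {e \<in> Y. h' e = j} \<union> {e \<in> Y. h' e = k}"
        unfolding j k using Y by (auto simp: T_def)
      also have "card \<dots> = card {e \<in> Y. h' e = j} + card {e \<in> Y. h' e = k}"
        using Y \<open>j \<noteq> k\<close> by (subst card_Un_disjoint) auto
      finally show "card {e \<in> Y. h e = j} + card {e \<in> Y. h e = k} = card {e \<in> Y. h' e = j} + card {e \<in> Y. h' e = k}" .
    qed
    \<comment> \<open>No set of \<open>F\<close> gains by the recolouring, and \<open>X\<close>,
      whose classes \<open>j\<close> and \<open>k\<close> differed by more than one, strictly
      loses.\<close>
    have "pot h' < pot h" unfolding pot_def
    proof (rule sum_strict_mono_ex1[OF finF])
      show "\<forall>Y\<in>F. (\<Sum>i<m. (card {e \<in> Y. h' e = i})\<^sup>2) \<le> (\<Sum>i<m. (card {e \<in> Y. h e = i})\<^sup>2)"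
        unfolding decomp using rest sum_squares_even_split(1)[OF two] by auto
      show "\<exists>Y\<in>F. (\<Sum>i<m. (card {e \<in> Y. h' e = i})\<^sup>2) < (\<Sum>i<m. (card {e \<in> Y. h e = i})\<^sup>2)"
        unfolding decomp using rest[OF X] sum_squares_even_split(2)[OF two[OF X]] bad X
        by (intro bexI[of _ X]) auto
    qed
    then show False using min[OF h'] by simp
  qed
  then show ?thesis using h by blast
qed

text \<open>Says without division that the size of \<open>X \<inter> S\<close> is
  \<open>card X / m\<close> rounded down or up.\<close>

definition fair_share :: "nat \<Rightarrow> 'a set \<Rightarrow> 'a set \<Rightarrow> bool" where
  "fair_share m S X \<longleftrightarrow> m * card (X \<inter> S) < card X + m \<and> card X < m * card (X \<inter> S) + m"

text \<open>\<open>S\<close> is one class of a colouring with \<open>m\<close> colours that is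
  equitable on all fibres at once.\<close>

lemma equitable_selection:
  fixes E :: "'a set" and m :: nat
  assumes "finite E" and refines: "\<And>x y. g1 x = g1 y \<Longrightarrow> g2 x = g2 y" and "m > 0"
  shows "\<exists>S\<subseteq>E. (\<forall>z. fair_share m S {x \<in> E. g1 x = z}) \<and> (\<forall>z. fair_share m S {x \<in> E. g2 x = z}) \<and>
    (\<forall>z. fair_share m S {x \<in> E. g3 x = z})"
proof -
  let ?F = "range (\<lambda>z. {x \<in> E. g1 x = z}) \<union> range (\<lambda>z. {x \<in> E. g2 x = z}) \<union> range (\<lambda>z. {x \<in> E. g3 x = z})"
  have "\<exists>f. \<forall>X\<in>?F. split_evenly (X \<inter> T) f" if "T \<subseteq> E" for T
  proof -
    have "finite T" using that assms(1) by (rule finite_subset)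
    from even_split_of_fibres[of T g1 g2 g3, OF this refines] obtain f
      where f: "\<And>z. split_evenly {x \<in> T. g1 x = z} f" "\<And>z. split_evenly {x \<in> T. g2 x = z} f" "\<And>z. split_evenly {x \<in> T. g3 x = z} f"
      by blast
    have "{x \<in> E. g1 x = z} \<inter> T = {x \<in> T. g1 x = z}" "{x \<in> E. g2 x = z'} \<inter> T = {x \<in> T. g2 x = z'}"
      "{x \<in> E. g3 x = z''} \<inter> T = {x \<in> T. g3 x = z''}" for z z' z'' using that by auto
    then have "split_evenly ({x \<in> E. g1 x = z} \<inter> T) f" "split_evenly ({x \<in> E. g2 x = z'} \<inter> T) f"
      "split_evenly ({x \<in> E. g3 x = z''} \<inter> T) f" for z z' z''
      using f by simp_all
    then show ?thesis by (intro exI[of _ f]) auto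
  qed
  then have "\<exists>h. (\<forall>e\<in>E. h e < m) \<and> (\<forall>X\<in>?F. \<forall>j<m. \<forall>k<m. card {e \<in> X. h e = j} \<le> card {e \<in> X. h e = k} + 1)"
    using assms(1,3) by (intro equitable_colouring) auto
  then obtain h where h: "\<forall>e\<in>E. h e < m"
    and bal: "\<forall>X\<in>?F. \<forall>j<m. \<forall>k<m. card {e \<in> X. h e = j} \<le> card {e \<in> X. h e = k} + 1" by blast
  define S where "S = {e \<in> E. h e = 0}"
  have "fair_share m S X" if X: "X \<in> ?F" for X
  proof -
    have XE: "X \<subseteq> E" "finite X" using X assms(1) by (auto intro: finite_subset)
    have XS: "X \<inter> S = {e \<in> X. h e = 0}" using XE by (auto simp: S_def)
    let ?c = "\<lambda>j. card {e \<in> X. h e = j}"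
    have "card X = card (\<Union>j<m. {e \<in> X. h e = j})" using h XE by (intro arg_cong[where f = card]) auto
    also have "\<dots> = (\<Sum>j<m. ?c j)" using XE by (subst card_UN_disjoint) auto
    also have "{..<m} = insert 0 {1..<m}" using assms(3) by auto
    also have "sum ?c \<dots> = ?c 0 + (\<Sum>j=1..<m. ?c j)" by simp
    finally have sum: "card X = ?c 0 + (\<Sum>j=1..<m. ?c j)" .
    \<comment> \<open>Comparing class 0 with each of the other \<open>m - 1\<close> classes and
      adding up bounds its size from both sides.\<close>
    have "(\<Sum>j=1..<m. ?c 0) \<le> (\<Sum>j=1..<m. ?c j + 1)" "(\<Sum>j=1..<m. ?c j) \<le> (\<Sum>j=1..<m. ?c 0 + 1)"
      using bal[rule_format, OF X] assms(3) by (intro sum_mono; simp)+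
    then have "(m - 1) * ?c 0 \<le> (\<Sum>j=1..<m. ?c j) + (m - 1)" "(\<Sum>j=1..<m. ?c j) \<le> (m - 1) * ?c 0 + (m - 1)"
      by (simp_all add: sum_Suc)
    moreover have "m * ?c 0 = (m - 1) * ?c 0 + ?c 0" using assms(3) by (cases m) auto
    ultimately show ?thesis unfolding fair_share_def XS using sum assms(3) by linarith
  qed
  then show ?thesis by (intro exI[of _ S]) (auto simp: S_def)
qed

section \<open>Linear forests\<close>

fun path_edges :: "nat list \<Rightarrow> nat set set" where
  "path_edges [] = {}"
| "path_edges [x] = {}"
| "path_edges (x # y # p) = insert {x, y} (path_edges (y # p))"

lemma path_edges_append:
  "p \<noteq> [] \<Longrightarrow> q \<noteq> [] \<Longrightarrow> path_edges (p @ q) = insert {last p, hd q} (path_edges p \<union> path_edges q)"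
proof (induction p rule: path_edges.induct)
  case (2 x)
  then show ?case by (cases q) auto
qed auto

lemma path_edges_rev: "path_edges (rev p) = path_edges p"
proof (induction p rule: path_edges.induct)
  case (3 x y p)
  then show ?case by (simp add: path_edges_append[of "rev (y # p)" "[x]", simplified] insert_commute)
qed auto

lemma path_edges_nth: "path_edges p = {{p ! i, p ! Suc i} | i. Suc i < length p}"
proof (induction p rule: path_edges.induct)
  case (3 x y p)
  have "{{(x # y # p) ! i, (x # y # p) ! Suc i} | i. Suc i < length (x # y # p)} =
    insert {x, y} {{(y # p) ! i, (y # p) ! Suc i} | i. Suc i < length (y # p)}" (is "?L = ?R")
  proof (intro equalityI subsetI)
    fix e assume "e \<in> ?L"
    then obtain i where "e = {(x # y # p) ! i, (x # y # p) ! Suc i}" "Suc i < length (x # y # p)" by blast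
    then show "e \<in> ?R" by (cases i) auto
  next
    fix e assume "e \<in> ?R"
    then consider "e = {x, y}" | i where "e = {(y # p) ! i, (y # p) ! Suc i}" "Suc i < length (y # p)" by blast
    then show "e \<in> ?L"
    proof cases
      case 1
      then show ?thesis by (intro CollectI exI[of _ 0]) auto
    next
      case 2
      then show ?thesis by (intro CollectI exI[of _ "Suc i"]) auto
    qed
  qed
  then show ?case using 3 by simp
qed auto

lemma cycle_edges_path_edges:
  assumes "c \<noteq> []"
  shows "cycle_edges c = insert {last c, hd c} (path_edges c)"
proof -
  have "{c ! i, c ! ((i + 1) mod length c)} \<in> insert {last c, hd c} (path_edges c)" if "i < length c" for i
  proof (cases "Suc i < length c")
    case True
    then show ?thesis by (auto simp: path_edges_nth)
  next
    case False
    then have "Suc i = length c" using that by simp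
    then have "i = length c - 1" "(i + 1) mod length c = 0" by auto
    then show ?thesis using assms by (auto simp: last_conv_nth hd_conv_nth)
  qed
  moreover have "{c ! i, c ! Suc i} \<in> cycle_edges c" if "Suc i < length c" for i
    using that unfolding cycle_edges_def by (intro CollectI exI[of _ i]) auto
  moreover have "{last c, hd c} \<in> cycle_edges c"
    using assms unfolding cycle_edges_def
    by (intro CollectI exI[of _ "length c - 1"]) (auto simp: last_conv_nth hd_conv_nth)
  ultimately show ?thesis unfolding path_edges_nth by (auto simp: cycle_edges_def)
qed

lemma path_edges_subset: "e \<in> path_edges p \<Longrightarrow> e \<subseteq> set p"
  by (induction p rule: path_edges.induct) auto

lemma cycle_edges_subset: "e \<in> cycle_edges c \<Longrightarrow> e \<subseteq> set c"
  unfolding cycle_edges_def by (auto intro!: nth_mem mod_less_divisor)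

text \<open>The flag names an end rather than a vertex: a one-vertex path has two ends at the same
  vertex.\<close>

definition path_end :: "nat list \<Rightarrow> bool \<Rightarrow> nat" where
  "path_end p b = (if b then hd p else last p)"

definition end_last :: "nat list \<Rightarrow> bool \<Rightarrow> nat list" where
  "end_last p b = (if b then rev p else p)"

lemma end_last_simps [simp]:
  "set (end_last p b) = set p" "distinct (end_last p b) = distinct p" "end_last p b = [] \<longleftrightarrow> p = []"
  "path_edges (end_last p b) = path_edges p"
  by (auto simp: end_last_def path_edges_rev)

lemma last_end_last: "p \<noteq> [] \<Longrightarrow> last (end_last p b) = path_end p b"
  and hd_end_last: "p \<noteq> [] \<Longrightarrow> hd (end_last p b) = path_end p (\<not> b)"
  by (auto simp: end_last_def path_end_def last_rev hd_rev)

text \<open>Each path is stored in one of its two orientations, an isolated vertex as a one-element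
  list.\<close>

definition linear_forest :: "nat set \<Rightarrow> nat list set \<Rightarrow> bool" where
  "linear_forest X P \<longleftrightarrow> finite P \<and> (\<forall>p\<in>P. p \<noteq> [] \<and> distinct p) \<and>
     (\<forall>p\<in>P. \<forall>q\<in>P. p \<noteq> q \<longrightarrow> set p \<inter> set q = {}) \<and> (\<Union>p\<in>P. set p) = X"

definition forest_edges :: "nat list set \<Rightarrow> nat set set" where
  "forest_edges P = (\<Union>p\<in>P. path_edges p)"

text \<open>An isolated vertex counts twice, so this is two minus the degree for the vertices of the forest.\<close>

definition free_ends :: "nat list set \<Rightarrow> nat \<Rightarrow> nat" where
  "free_ends P a = (\<Sum>p\<in>P. of_bool (hd p = a) + of_bool (last p = a))"

lemma linear_forest_insert_vertex:
  assumes "linear_forest X P" and "r \<notin> X"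
  shows "linear_forest (insert r X) (insert [r] P)" and "forest_edges (insert [r] P) = forest_edges P"
    and "card (insert [r] P) = card P + 1"
    and "free_ends (insert [r] P) a = free_ends P a + (if a = r then 2 else 0)"
    and "[r] \<notin> P"
proof -
  show n: "[r] \<notin> P" using assms unfolding linear_forest_def by force
  show "linear_forest (insert r X) (insert [r] P)" using assms unfolding linear_forest_def by auto
  show "forest_edges (insert [r] P) = forest_edges P" by (auto simp: forest_edges_def)
  have "finite P" using assms by (auto simp: linear_forest_def)
  then show "card (insert [r] P) = card P + 1" "free_ends (insert [r] P) a = free_ends P a + (if a = r then 2 else 0)"
    using n by (auto simp: free_ends_def)
qed

text \<open>The new list runs through \<open>p\<close> towards its chosen end and then through
  \<open>q\<close> away from its chosen end. Its own ends are the two unchosen ones, so the new edge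
  uses up exactly the ends it joins.\<close>

lemma linear_forest_merge:
  fixes p q :: "nat list" and b b' :: bool
  assumes P: "linear_forest X P" and pq: "p \<in> P" "q \<in> P" "p \<noteq> q"
  defines "Q \<equiv> end_last p b @ rev (end_last q b')"
  defines "P' \<equiv> insert Q (P - {p, q})"
  shows "linear_forest X P'"
    and "forest_edges P' = insert {path_end p b, path_end q b'} (forest_edges P)"
    and "card P' + 1 = card P"
    and "free_ends P' a + of_bool (path_end p b = a) + of_bool (path_end q b' = a) = free_ends P a"
proof -
  have fin: "finite P" and ne: "p \<noteq> []" "q \<noteq> []" and dist: "distinct p" "distinct q" and dis: "set p \<inter> set q = {}"
    using P pq unfolding linear_forest_def by auto
  have setQ: "set Q = set p \<union> set q" by (auto simp: Q_def)
  have Qn: "Q \<notin> P - {p, q}"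
  proof
    assume "Q \<in> P - {p, q}"
    then have "set Q \<inter> set p = {}" using P pq unfolding linear_forest_def by auto
    then show False using setQ ne by auto
  qed
  have Pe: "P = insert p (insert q (P - {p, q}))" using pq by auto
  have dQ: "distinct Q" "Q \<noteq> []" using dist dis ne by (auto simp: Q_def)
  show "linear_forest X P'" unfolding linear_forest_def
  proof (intro conjI ballI impI)
    show "finite P'" using fin by (simp add: P'_def)
    show "(\<Union>p\<in>P'. set p) = X"
    proof -
      have "(\<Union>p\<in>P'. set p) = set p \<union> set q \<union> (\<Union>p\<in>P - {p, q}. set p)" by (auto simp: P'_def setQ)
      also have "\<dots> = (\<Union>p\<in>P. set p)" using pq by auto
      finally show ?thesis using P by (simp add: linear_forest_def)
    qed
    fix s assume s: "s \<in> P'"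
    show "s \<noteq> []" "distinct s" using s dQ P unfolding P'_def linear_forest_def by auto
    fix t assume t: "t \<in> P'" and "s \<noteq> t"
    have "set Q \<inter> set z = {}" if "z \<in> P - {p, q}" for z
      using that P pq unfolding setQ linear_forest_def by blast
    then show "set s \<inter> set t = {}" using s t \<open>s \<noteq> t\<close> P unfolding P'_def linear_forest_def by blast
  qed
  have "path_edges Q = insert {path_end p b, path_end q b'} (path_edges p \<union> path_edges q)"
    unfolding Q_def using ne by (subst path_edges_append) (auto simp: last_end_last hd_rev path_edges_rev)
  then show "forest_edges P' = insert {path_end p b, path_end q b'} (forest_edges P)"
    unfolding forest_edges_def P'_def using pq by auto
  have "card P = card (P - {p, q}) + 2"
    using pq fin by (subst Pe) simp
  then show "card P' + 1 = card P" unfolding P'_def using Qn fin by simp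
  have ends: "hd Q = path_end p (\<not> b)" "last Q = path_end q (\<not> b')"
    using ne by (auto simp: Q_def hd_end_last last_rev)
  let ?e = "\<lambda>p. of_bool (hd p = a) + of_bool (last p = a) :: nat"
  have "free_ends P a = ?e p + ?e q + (\<Sum>s\<in>P-{p,q}. ?e s)"
    unfolding free_ends_def using pq fin by (subst Pe) simp
  moreover have "free_ends P' a = of_bool (path_end p (\<not> b) = a) + of_bool (path_end q (\<not> b') = a) + (\<Sum>s\<in>P-{p,q}. ?e s)"
    unfolding free_ends_def P'_def using Qn fin by (simp add: ends)
  moreover have "?e z = of_bool (path_end z c = a) + of_bool (path_end z (\<not> c) = a)" for z c by (auto simp: path_end_def)
  from this[of p b] this[of q b'] calculation
  show "free_ends P' a + of_bool (path_end p b = a) + of_bool (path_end q b' = a) = free_ends P a" by linarith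
qed

text \<open>The vertex \<open>r\<close> enters as a one-vertex path with two free ends and is merged
  with the selected ends, at most two. Injectivity of \<open>fst\<close> puts them on different
  paths; otherwise \<open>r\<close> would close a cycle.\<close>

lemma linear_forest_attach_vertex:
  assumes P: "linear_forest X P" and r: "r \<notin> X" and S: "S \<subseteq> P \<times> UNIV" "card S \<le> 2" "inj_on fst S"
  obtains P' where "linear_forest (insert r X) P'"
    and "forest_edges P' = forest_edges P \<union> (\<lambda>(p, b). {r, path_end p b}) ` S"
    and "card P' + card S = card P + 1" and "P' \<noteq> {}"
    and "\<And>a. a \<noteq> r \<Longrightarrow> free_ends P' a + card {s \<in> S. case_prod path_end s = a} = free_ends P a"
    and "free_ends P' r + card S = 2"
proof -
  note ins = linear_forest_insert_vertex[OF P r]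
  have finS: "finite S" using P S(1) unfolding linear_forest_def by (meson finite_SigmaI finite_subset finite_UNIV finite)
  have noend: "path_end p b \<in> X" if "(p, b) \<in> S" for p b
  proof -
    have "p \<in> P" using that S(1) by auto
    then show ?thesis using P unfolding linear_forest_def path_end_def by (auto intro!: bexI[of _ p])
  qed
  have end_r: "path_end [r] False = r" by (simp add: path_end_def)
  have fr: "free_ends P r = 0"
  proof -
    have "hd p \<noteq> r \<and> last p \<noteq> r" if "p \<in> P" for p
      using that P r unfolding linear_forest_def by (metis UN_I hd_in_set last_in_set)
    then show ?thesis by (simp add: free_ends_def)
  qed
  consider "S = {}" | t where "S = {t}" | t t' where "S = {t, t'}" "t \<noteq> t'"
  proof -
    have "card S = 0 \<or> card S = 1 \<or> card S = 2" using S(2) by linarith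
    then show thesis using that finS by (metis card_0_eq card_1_singletonE card_2_iff)
  qed
  then show thesis
  proof cases
    case 1
    then show ?thesis using that[OF ins(1)] ins(2-4) r fr by fastforce
  next
    case (2 t)
    obtain p b where t: "t = (p, b)" by force
    have p: "p \<in> P" "p \<noteq> [r]" using 2 S(1) t ins(5) by auto
    define P1 where "P1 = insert (end_last p b @ rev (end_last [r] False)) (insert [r] P - {p, [r]})"
    note m = linear_forest_merge[OF ins(1) insertI2[OF p(1)] insertI1 p(2), of b False, folded P1_def, unfolded end_r]
    show ?thesis
    proof (rule that[OF m(1)])
      show "free_ends P1 a + card {s \<in> S. case_prod path_end s = a} = free_ends P a" if "a \<noteq> r" for a
      proof -
        have "card {s \<in> S. case_prod path_end s = a} = of_bool (path_end p b = a)" using 2 t by (auto simp: Collect_conv_if)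
        moreover have "a \<noteq> r" "r \<noteq> a" using that by auto
        ultimately show ?thesis using m(4)[of a] ins(4)[of a] by simp
      qed
      have "path_end p b \<noteq> r" using noend[of p b] 2 t r by auto
      then show "free_ends P1 r + card S = 2" using m(4)[of r] ins(4)[of r] fr 2 by simp
      show "forest_edges P1 = forest_edges P \<union> (\<lambda>(p, b). {r, path_end p b}) ` S"
        unfolding m(2) ins(2) using 2 t by (auto simp: insert_commute)
      show "card P1 + card S = card P + 1" using m(3) ins(3) 2 by simp
      show "P1 \<noteq> {}" by (simp add: P1_def)
    qed
  next
    case (3 t t')
    obtain p b q b' where t: "t = (p, b)" "t' = (q, b')" by force
    have pq: "p \<in> P" "q \<in> P" "p \<noteq> [r]" "q \<noteq> [r]" using 3 S(1) t ins(5) by auto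
    have neq: "p \<noteq> q" using 3 S(3) t by (auto simp: inj_on_def)
    define P1 where "P1 = insert (end_last p b @ rev (end_last [r] False)) (insert [r] P - {p, [r]})"
    note m = linear_forest_merge[OF ins(1) insertI2[OF pq(1)] insertI1 pq(3), of b False, folded P1_def, unfolded end_r]
    define Q where "Q = end_last p b @ rev (end_last [r] False)"
    have Q: "Q \<in> P1" "q \<in> P1" using pq neq by (auto simp: P1_def Q_def)
    have "q \<noteq> Q"
    proof
      assume "q = Q"
      then have "r \<in> set q" by (simp add: Q_def end_last_def)
      then show False using pq P r unfolding linear_forest_def by auto
    qed
    \<comment> \<open>The first merge leaves \<open>r\<close> as the last vertex of
      \<open>Q\<close>, so the flag \<open>False\<close> picks its remaining end.\<close>
    have lastQ: "path_end Q False = r" by (simp add: Q_def path_end_def end_last_def)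
    note m2 = linear_forest_merge[OF m(1) Q \<open>q \<noteq> Q\<close>[symmetric], of False b', unfolded lastQ]
    define P2 where "P2 = insert (end_last Q False @ rev (end_last q b')) (P1 - {Q, q})"
    note m2' = m2[folded P2_def]
    have cS: "card S = 2" using 3 by simp
    show ?thesis
    proof (rule that[OF m2'(1)])
      show "forest_edges P2 = forest_edges P \<union> (\<lambda>(p, b). {r, path_end p b}) ` S"
        unfolding m2'(2) m(2) ins(2) using 3 t by (auto simp: insert_commute)
      show "card P2 + card S = card P + 1" using m2'(3) m(3) ins(3) cS by linarith
      show "P2 \<noteq> {}" by (simp add: P2_def)
      show "free_ends P2 a + card {s \<in> S. case_prod path_end s = a} = free_ends P a" if "a \<noteq> r" for a
      proof -
        have "{s \<in> S. case_prod path_end s = a} = (if path_end p b = a then {t} else {}) \<union> (if path_end q b' = a then {t'} else {})"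
          using 3 t by auto
        then have "card {s \<in> S. case_prod path_end s = a} = of_bool (path_end p b = a) + of_bool (path_end q b' = a)"
          using 3 by auto
        moreover have "a \<noteq> r" "r \<noteq> a" using that by auto
        ultimately show ?thesis using m(4)[of a] m2'(4)[of a] ins(4)[of a] by simp
      qed
      have "path_end p b \<noteq> r" "path_end q b' \<noteq> r" using noend[of p b] noend[of q b'] 3 t r by auto
      then show "free_ends P2 r + card S = 2" using m(4)[of r] m2'(4)[of r] ins(4)[of r] fr cS by simp
    qed
  qed
qed

section \<open>Adding vertices\<close>

text \<open>Treats ends as pairs of a path and a flag, so that the ends at a vertex form a fibre to
  which fair selection applies.\<close>

lemma free_ends_eq_card:
  assumes "finite P"
  shows "free_ends P a = card {(p, b). p \<in> P \<and> path_end p b = a}"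
proof -
  have "{(p, b). p \<in> P \<and> path_end p b = a} = Sigma P (\<lambda>p. {b. path_end p b = a})" by auto
  moreover have "card {b. path_end p b = a} = of_bool (hd p = a) + of_bool (last p = a)" for p
  proof -
    have "{b. path_end p b = a} = (if hd p = a then {True} else {}) \<union> (if last p = a then {False} else {})"
      by (auto simp: path_end_def split: if_splits)
    then show ?thesis by simp
  qed
  ultimately show ?thesis using assms by (simp add: free_ends_def)
qed

text \<open>Index \<open>n\<close> carries the matching, so that disjointness and covering concern a
  single indexed family. \<open>G c\<close> holds the small cycles of colour \<open>c\<close>,
  \<open>P c\<close> its forest.\<close>

definition colour_class ::
    "nat \<Rightarrow> (nat \<Rightarrow> nat list list) \<Rightarrow> (nat \<Rightarrow> nat list set) \<Rightarrow> nat set set \<Rightarrow> nat \<Rightarrow> nat set set" where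
  "colour_class n G P I c = (if c < n then (\<Union>k\<in>set (G c). cycle_edges k) \<union> forest_edges (P c) else I)"

text \<open>\<open>U\<close> is the set of vertices not yet covered by the matching \<open>I\<close>, and \<open>m\<close> is the number
  of vertices that are still to be added. The flag tells whether the final order is even.\<close>

definition partial_matching :: "bool \<Rightarrow> nat \<Rightarrow> nat \<Rightarrow> nat set set \<Rightarrow> nat set \<Rightarrow> bool" where
  "partial_matching ev r m I U \<longleftrightarrow> U \<subseteq> {..<r} \<and>
     (if ev then card U \<le> m \<and> even (m + card U) \<and>
        (\<forall>a<r. if a \<in> U then \<forall>e\<in>I. a \<notin> e else \<exists>!e. e \<in> I \<and> a \<in> e)
      else U = {} \<and> I = {})"

text \<open>The invariant with \<open>r\<close> vertices present and \<open>m\<close> missing. A new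
  vertex lowers the number of paths by at most one and the last must close a single path, hence at
  most \<open>m\<close> paths. The last condition reserves at each vertex one end for every missing
  vertex, membership in \<open>U\<close> counting as an end.\<close>

definition partial_solution ::
    "bool \<Rightarrow> nat \<Rightarrow> (nat \<Rightarrow> nat list list) \<Rightarrow> nat \<Rightarrow> nat \<Rightarrow> (nat \<Rightarrow> nat list set) \<Rightarrow> nat set set \<Rightarrow> nat set \<Rightarrow> bool" where
  "partial_solution ev n G r m P I U \<longleftrightarrow>
     r + m = 2 * n + 1 + of_bool ev \<and>
     (\<forall>c<n. set (concat (G c)) \<subseteq> {..<r} \<and> linear_forest ({..<r} - set (concat (G c))) (P c) \<and>
        P c \<noteq> {} \<and> card (P c) \<le> m) \<and>
     disjoint_family_on (colour_class n G P I) {..n} \<and>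
     (\<Union>c\<le>n. colour_class n G P I c) = complete_edges r \<and>
     partial_matching ev r m I U \<and>
     (\<forall>a<r. (\<Sum>c<n. free_ends (P c) a) + of_bool (a \<in> U) = m)"

lemma complete_edges_Suc: "complete_edges (Suc r) = complete_edges r \<union> {{r, a} | a. a < r}"
  unfolding complete_edges_def by (auto simp: less_Suc_eq insert_commute)

text \<open>\<open>f a\<close> is the colour given to the edge between the new vertex
  \<open>r\<close> and \<open>a\<close>.\<close>

lemma disjoint_family_extend:
  assumes "disjoint_family_on A {..n}" and "(\<Union>c\<le>n. A c) = complete_edges r" and "\<And>a. a < r \<Longrightarrow> f a \<le> n"
  defines "A' \<equiv> \<lambda>c. A c \<union> {{r, a} | a. a < r \<and> f a = c}"
  shows "disjoint_family_on A' {..n}" and "(\<Union>c\<le>n. A' c) = complete_edges (Suc r)"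
proof -
  define N where "N c = {{r, a} | a. a < r \<and> f a = c}" for c
  have old_new: "A c \<inter> N c' = {}" if "c \<le> n" for c c'
  proof -
    have "A c \<subseteq> complete_edges r" using that assms(2) by auto
    then show ?thesis by (auto simp: complete_edges_def N_def doubleton_eq_iff)
  qed
  have new_new: "N c \<inter> N c' = {}" if "c \<noteq> c'" for c c' using that by (auto simp: N_def doubleton_eq_iff)
  show "disjoint_family_on A' {..n}"
    unfolding disjoint_family_on_def
  proof (intro ballI impI)
    fix c c' assume c: "c \<in> {..n}" "c' \<in> {..n}" "c \<noteq> c'"
    then have "A c \<inter> A c' = {}" using assms(1) by (auto simp: disjoint_family_on_def)
    moreover have "A c \<inter> N c' = {}" "A c' \<inter> N c = {}" "N c \<inter> N c' = {}" using c old_new new_new by auto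
    ultimately show "A' c \<inter> A' c' = {}" unfolding A'_def N_def[symmetric] by blast
  qed
  show "(\<Union>c\<le>n. A' c) = complete_edges (Suc r)"
    unfolding complete_edges_Suc assms(2)[symmetric] A'_def using assms(3) by auto
qed

text \<open>The set \<open>W\<close> contains the old vertex to be matched with \<open>r\<close>, if
  there is one; otherwise \<open>r\<close> itself becomes uncovered and waits for a later
  vertex.\<close>

lemma partial_matching_extend:
  assumes pm: "partial_matching ev r m I U" and I: "I \<subseteq> complete_edges r" and m: "m \<ge> 1"
    and W: "W \<subseteq> U" "card W \<le> 1" "card U = m \<Longrightarrow> W \<noteq> {}"
  obtains U' where "partial_matching ev (Suc r) (m - 1) (I \<union> {{r, a} | a. a \<in> W}) U'"
    and "\<And>a. a < r \<Longrightarrow> of_bool (a \<in> U') + of_bool (a \<in> W) = (of_bool (a \<in> U) :: nat)"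
    and "of_bool (r \<in> U') + card W = of_bool ev"
proof (cases ev)
  case False
  then show ?thesis using that[of "{}"] pm W unfolding partial_matching_def by auto
next
  case True
  have U: "U \<subseteq> {..<r}" "card U \<le> m" "even (m + card U)"
    and free: "\<And>a. a \<in> U \<Longrightarrow> \<forall>e\<in>I. a \<notin> e"
    and matched: "\<And>a. a < r \<Longrightarrow> a \<notin> U \<Longrightarrow> \<exists>!e. e \<in> I \<and> a \<in> e"
    using pm True unfolding partial_matching_def by (auto split: if_splits)
  have fin: "finite U" using U(1) finite_subset by blast
  have rU: "r \<notin> U" using U(1) by auto
  have Ir: "\<And>e. e \<in> I \<Longrightarrow> r \<notin> e" using I by (auto simp: complete_edges_def)
  show ?thesis
  proof (cases "W = {}")
    case W0: True
    \<comment> \<open>Parity excludes \<open>m - 1\<close> as well, so \<open>card U\<close> is at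
      most \<open>m - 2\<close> and there is room for \<open>r\<close> among the uncovered
      vertices.\<close>
    have "card U \<noteq> m" using W(3) W0 by blast
    moreover have "card U \<noteq> m - 1" using U(3) m by (cases m) auto
    ultimately have "card U + 1 \<le> m - 1" using U(2) m by linarith
    moreover have "even (m - 1 + card (insert r U))" using U(3) fin rU m by (cases m) auto
    ultimately have "partial_matching ev (Suc r) (m - 1) I (insert r U)"
      unfolding partial_matching_def using True U(1) fin rU free matched Ir by (auto simp: less_Suc_eq)
    then show ?thesis using that[of "insert r U"] W0 rU True by auto
  next
    case False
    then have "card W = 1" using W(1,2) fin by (metis card_gt_0_iff finite_subset less_one nat_less_le)
    then obtain a where "W = {a}" by (elim card_1_singletonE)
    then have a: "W = {a}" "a \<in> U" using W(1) by auto
    have ar: "a < r" using a U(1) by auto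
    have "card (U - {a}) = card U - 1" "card U \<ge> 1" using a fin by (auto simp: Suc_le_eq card_gt_0_iff)
    then have "card (U - {a}) \<le> m - 1" "even (m - 1 + card (U - {a}))" using U(2,3) m by auto
    moreover have "\<exists>!e. e \<in> insert {r, a} I \<and> z \<in> e" if z: "z < Suc r" "z \<notin> U - {a}" for z
    proof -
      have "z = r \<or> z = a \<or> z < r \<and> z \<notin> U \<and> z \<noteq> a" using z by auto
      then consider "z = r" | "z = a" | "z < r" "z \<notin> U" "z \<noteq> a" by blast
      then show ?thesis
      proof cases
        case 1
        then show ?thesis using Ir by (intro ex1I[of _ "{r, a}"]) auto
      next
        case 2
        then show ?thesis using free[OF a(2)] by (intro ex1I[of _ "{r, a}"]) auto
      next
        case 3
        then show ?thesis using matched[of z] by auto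
      qed
    qed
    ultimately have "partial_matching ev (Suc r) (m - 1) (insert {r, a} I) (U - {a})"
      unfolding partial_matching_def using True U(1) free ar by auto
    then show ?thesis using that[of "U - {a}"] a rU True by auto
  qed
qed

section \<open>Choosing the edges at a new vertex\<close>

text \<open>A fair selection among all free ends, taken with respect to paths, colours and vertices.
  Paths refine colours, as the nested pair of partitions requires. The selected end at
  \<open>a\<close> determines the colour \<open>f a\<close> of the new edge at \<open>a\<close>, and
  \<open>S c\<close> collects the selected ends of colour \<open>c\<close>.\<close>

lemma partial_solution_selection:
  assumes ps: "partial_solution ev n G r m P I U" and m: "m \<ge> 1"
  obtains f S where "\<And>a. a < r \<Longrightarrow> f a \<le> n"
    and "\<And>c. c < n \<Longrightarrow> S c \<subseteq> P c \<times> UNIV"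
    and "\<And>c. c < n \<Longrightarrow> bij_betw (case_prod path_end) (S c) {a. a < r \<and> f a = c}"
    and "\<And>c. c < n \<Longrightarrow> m * card (S c) < 2 * card (P c) + m \<and> 2 * card (P c) < m * card (S c) + m"
    and "\<And>c. c < n \<Longrightarrow> m \<ge> 2 \<Longrightarrow> inj_on fst (S c)"
    and "{a. a < r \<and> f a = n} \<subseteq> U"
    and "m * card {a. a < r \<and> f a = n} < card U + m" and "card U < m * card {a. a < r \<and> f a = n} + m"
proof -
  have P: "\<And>c. c < n \<Longrightarrow> linear_forest ({..<r} - set (concat (G c))) (P c)"
    and ends: "\<And>a. a < r \<Longrightarrow> (\<Sum>c<n. free_ends (P c) a) + of_bool (a \<in> U) = m"
    and U: "U \<subseteq> {..<r}"
    using ps unfolding partial_solution_def partial_matching_def by auto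
  have finP: "\<And>c. c < n \<Longrightarrow> finite (P c)" using P by (auto simp: linear_forest_def)
  have finU: "finite U" using U finite_subset by blast
  \<comment> \<open>Besides the real free ends, every vertex not covered by the matching gets one
    artificial end of colour \<open>n\<close>.\<close>
  define E where "E = (SIGMA c:{..<n}. P c \<times> UNIV) \<union> (\<lambda>a. (n, [a], True)) ` U"
  define vert :: "nat \<times> nat list \<times> bool \<Rightarrow> nat" where "vert = (\<lambda>(c, p, b). path_end p b)"
  define path :: "nat \<times> nat list \<times> bool \<Rightarrow> nat \<times> nat list" where "path = (\<lambda>(c, p, b). (c, p))"
  have finE: "finite E" using finP finU by (auto simp: E_def)
  have vert_less: "vert t < r" if "t \<in> E" for t
  proof -
    have "path_end p b < r" if "c < n" "p \<in> P c" for c p b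
    proof -
      have "p \<noteq> []" "set p \<subseteq> {..<r}" using P[OF that(1)] that(2) by (auto simp: linear_forest_def)
      then show ?thesis by (metis hd_in_set last_in_set lessThan_iff path_end_def subsetD)
    qed
    then show ?thesis using that U by (auto simp: E_def vert_def path_end_def)
  qed
  have "\<exists>S\<subseteq>E. (\<forall>z. fair_share m S {x \<in> E. path x = z}) \<and> (\<forall>z. fair_share m S {x \<in> E. fst x = z}) \<and>
    (\<forall>z. fair_share m S {x \<in> E. vert x = z})"
    using finE m by (intro equitable_selection) (auto simp: path_def split: prod.splits)
  then obtain S where SE: "S \<subseteq> E" and S1: "\<And>z. fair_share m S {x \<in> E. path x = z}"
    and S2: "\<And>z. fair_share m S {x \<in> E. fst x = z}" and S3: "\<And>z. fair_share m S {x \<in> E. vert x = z}"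
    by blast
  have finS: "finite S" using SE finE finite_subset by blast
  have Int_S: "{x \<in> E. Q x} \<inter> S = {x \<in> S. Q x}" for Q using SE by auto
  have one: "\<exists>!t. t \<in> S \<and> vert t = a" if a: "a < r" for a
  proof -
    have finV: "finite {(p, b). p \<in> P c \<and> path_end p b = a}" if "c < n" for c
      by (rule finite_subset[of _ "P c \<times> UNIV"]) (use finP[OF that] in auto)
    have "{t \<in> E. vert t = a} = (SIGMA c:{..<n}. {(p, b). p \<in> P c \<and> path_end p b = a}) \<union> (\<lambda>a. (n, [a], True)) ` (U \<inter> {a})"
      by (auto simp: E_def vert_def path_end_def)
    also have "card \<dots> = card (SIGMA c:{..<n}. {(p, b). p \<in> P c \<and> path_end p b = a}) + card ((\<lambda>a. (n, [a], True)) ` (U \<inter> {a}))"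
      using finV finU by (intro card_Un_disjoint finite_SigmaI finite_imageI) auto
    also have "card (SIGMA c:{..<n}. {(p, b). p \<in> P c \<and> path_end p b = a}) = (\<Sum>c<n. free_ends (P c) a)"
      using finV finP by (subst card_SigmaI) (auto simp: free_ends_eq_card)
    also have "card ((\<lambda>a. (n, [a], True)) ` (U \<inter> {a})) = of_bool (a \<in> U)" by auto
    finally have cm: "card {t \<in> E. vert t = a} = m" using ends[OF a] by simp
    have "m * card {t \<in> S. vert t = a} < m + m" "m < m * card {t \<in> S. vert t = a} + m"
      using S3[of a] unfolding fair_share_def Int_S cm by auto
    \<comment> \<open>Exactly \<open>m\<close> ends sit at \<open>a\<close>, so a fair share of them
      is a single end.\<close>
    then have "m * card {t \<in> S. vert t = a} < m * 2" "0 < m * card {t \<in> S. vert t = a}" by linarith+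
    then have "card {t \<in> S. vert t = a} < 2" "0 < card {t \<in> S. vert t = a}" by simp_all
    then have "card {t \<in> S. vert t = a} = 1" by linarith
    then obtain t where t: "{t \<in> S. vert t = a} = {t}" by (elim card_1_singletonE)
    then show ?thesis by (intro ex1I[of _ t]) blast+
  qed
  have uniq: "t = t'" if "t \<in> S" "t' \<in> S" "vert t = vert t'" for t t'
    using one[OF vert_less[of t]] SE that by (metis subsetD)
  define f where "f a = fst (THE t. t \<in> S \<and> vert t = a)" for a
  have f: "f (vert t) = fst t" if "t \<in> S" for t
  proof -
    have "(THE t'. t' \<in> S \<and> vert t' = vert t) = t"
      by (rule the1_equality[OF one[OF vert_less]]) (use that SE in auto)
    then show ?thesis by (simp add: f_def)
  qed
  define T where "T c = {(p, b). (c, p, b) \<in> S}" for c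
  have bij: "bij_betw vert {t \<in> S. fst t = c} {a. a < r \<and> f a = c}" for c
  proof (rule bij_betwI')
    fix t t' assume "t \<in> {t \<in> S. fst t = c}" "t' \<in> {t \<in> S. fst t = c}"
    then show "vert t = vert t' \<longleftrightarrow> t = t'" using uniq[of t t'] by auto
  next
    fix t assume "t \<in> {t \<in> S. fst t = c}"
    then show "vert t \<in> {a. a < r \<and> f a = c}" using f[of t] vert_less[of t] SE by auto
  next
    fix a assume "a \<in> {a. a < r \<and> f a = c}"
    moreover from this obtain t where "t \<in> S" "vert t = a" using one[of a] by auto
    ultimately show "\<exists>t\<in>{t \<in> S. fst t = c}. a = vert t" using f[of t] by (intro bexI[of _ t]) auto
  qed
  have bijT: "bij_betw (\<lambda>(p, b). (c, p, b)) (T c) {t \<in> S. fst t = c}" for c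
    by (rule bij_betw_byWitness[where f' = snd]) (auto simp: T_def)
  have bijV: "bij_betw (case_prod path_end) (T c) {a. a < r \<and> f a = c}" for c
  proof -
    have "vert \<circ> (\<lambda>(p, b). (c, p, b)) = case_prod path_end" by (auto simp: vert_def)
    then show ?thesis using bij_betw_trans[OF bijT bij, of c] by simp
  qed
  show thesis
  proof (rule that[of f T])
    show "f a \<le> n" if a: "a < r" for a
    proof -
      obtain t where "t \<in> S" "vert t = a" using one[OF a] by blast
      then show ?thesis using f[of t] SE by (auto simp: E_def)
    qed
    show "T c \<subseteq> P c \<times> UNIV" if "c < n" for c using that SE by (auto simp: T_def E_def)
    show "bij_betw (case_prod path_end) (T c) {a. a < r \<and> f a = c}" for c by (rule bijV)
    show "m * card (T c) < 2 * card (P c) + m \<and> 2 * card (P c) < m * card (T c) + m" if "c < n" for c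
    proof -
      have "{x \<in> E. fst x = c} = {c} \<times> P c \<times> UNIV" using that by (auto simp: E_def)
      then have "card {x \<in> E. fst x = c} = 2 * card (P c)" by (simp add: card_cartesian_product)
      moreover have "card {t \<in> S. fst t = c} = card (T c)" using bij_betw_same_card[OF bijT] by simp
      ultimately show ?thesis using S2[of c] unfolding fair_share_def Int_S by simp
    qed
    show "inj_on fst (T c)" if c: "c < n" and m2: "m \<ge> 2" for c
    proof (rule inj_onI)
      fix s s' assume s: "s \<in> T c" "s' \<in> T c" "fst s = fst s'"
      obtain p b b' where pb: "s = (p, b)" "s' = (p, b')" using s(3) by (metis prod.collapse)
      have "p \<in> P c" using s(1) pb SE c by (auto simp: T_def E_def)
      then have "{x \<in> E. path x = (c, p)} = {c} \<times> {p} \<times> UNIV" using c by (auto simp: E_def path_def)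
      then have c2: "card {x \<in> E. path x = (c, p)} = 2" by (simp add: card_cartesian_product)
      have "m * card {x \<in> S. path x = (c, p)} < 2 + m" using S1[of "(c, p)"] unfolding fair_share_def Int_S c2 by simp
      \<comment> \<open>A path has two ends, and for \<open>m \<ge> 2\<close> a fair share of two is
        at most one.\<close>
      then have "m * card {x \<in> S. path x = (c, p)} < m * 2" using m2 by linarith
      then have "card {x \<in> S. path x = (c, p)} \<le> 1" by simp
      moreover have "(c, p, b) \<in> {x \<in> S. path x = (c, p)}" "(c, p, b') \<in> {x \<in> S. path x = (c, p)}"
        using s pb by (auto simp: T_def path_def)
      ultimately show "s = s'" using pb finS by (auto simp: card_le_Suc0_iff_eq)
    qed
    show "{a. a < r \<and> f a = n} \<subseteq> U"
    proof -
      have "vert ` {t \<in> S. fst t = n} \<subseteq> U" using SE by (auto simp: E_def vert_def path_end_def)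
      then show ?thesis using bij_betw_imp_surj_on[OF bij[of n]] by simp
    qed
    have "{x \<in> E. fst x = n} = (\<lambda>a. (n, [a], True)) ` U" by (auto simp: E_def)
    then have "card {x \<in> E. fst x = n} = card U" by (simp add: card_image inj_on_def)
    moreover have "card {t \<in> S. fst t = n} = card {a. a < r \<and> f a = n}" by (rule bij_betw_same_card[OF bij])
    ultimately show "m * card {a. a < r \<and> f a = n} < card U + m" "card U < m * card {a. a < r \<and> f a = n} + m"
      using S2[of n] unfolding fair_share_def Int_S by simp_all
  qed
qed

section \<open>One extension step\<close>

lemma colour_class_extend:
  assumes c: "c \<le> n" and bij: "c < n \<Longrightarrow> bij_betw (case_prod path_end) (S c) {a. a < r \<and> f a = c}"
    and P': "c < n \<Longrightarrow> forest_edges (P' c) = forest_edges (P c) \<union> (\<lambda>(p, b). {r, path_end p b}) ` S c"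
  shows "colour_class n G P' (I \<union> {{r, a} | a. a \<in> {a. a < r \<and> f a = n}}) c =
    colour_class n G P I c \<union> {{r, a} | a. a < r \<and> f a = c}"
proof (cases "c < n")
  case True
  have "(\<lambda>(p, b). {r, path_end p b}) ` S c = (\<lambda>a. {r, a}) ` case_prod path_end ` S c"
    by (auto simp: image_image split_beta)
  also have "\<dots> = {{r, a} | a. a < r \<and> f a = c}" using bij_betw_imp_surj_on[OF bij[OF True]] by auto
  finally show ?thesis using True P' by (auto simp: colour_class_def)
next
  case False
  then show ?thesis using c by (auto simp: colour_class_def)
qed

lemma partial_solution_matching:
  assumes ps: "partial_solution ev n G r m P I U"
  shows "I \<subseteq> complete_edges r" "partial_matching ev r m I U"
proof -
  have "colour_class n G P I n \<subseteq> complete_edges r" using ps unfolding partial_solution_def by blast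
  then show "I \<subseteq> complete_edges r" by (simp add: colour_class_def)
  show "partial_matching ev r m I U" using ps by (simp add: partial_solution_def)
qed

lemma disjoint_family_on_cong: "(\<And>c. c \<in> J \<Longrightarrow> A c = B c) \<Longrightarrow> disjoint_family_on A J = disjoint_family_on B J"
  by (auto simp: disjoint_family_on_def)

text \<open>Fairness for paths prevents cycles, fairness for colours keeps the number of paths below
  the new bound, and the single selected end at each old vertex lowers its number of ends by
  one.\<close>

lemma partial_solution_step:
  assumes ps: "partial_solution ev n G r m P I U" and m: "m \<ge> 2"
  obtains P' I' U' where "partial_solution ev n G (Suc r) (m - 1) P' I' U'"
proof -
  have m1: "m \<ge> 1" using m by simp
  obtain f S where f: "\<And>a. a < r \<Longrightarrow> f a \<le> n"
    and S: "\<And>c. c < n \<Longrightarrow> S c \<subseteq> P c \<times> UNIV"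
    and bij: "\<And>c. c < n \<Longrightarrow> bij_betw (case_prod path_end) (S c) {a. a < r \<and> f a = c}"
    and num: "\<And>c. c < n \<Longrightarrow> m * card (S c) < 2 * card (P c) + m \<and> 2 * card (P c) < m * card (S c) + m"
    and inj: "\<And>c. c < n \<Longrightarrow> m \<ge> 2 \<Longrightarrow> inj_on fst (S c)"
    and W: "{a. a < r \<and> f a = n} \<subseteq> U"
    and numW: "m * card {a. a < r \<and> f a = n} < card U + m" "card U < m * card {a. a < r \<and> f a = n} + m"
    by (rule partial_solution_selection[OF ps m1]) (rule that, assumption+)
  \<comment> \<open>Colour \<open>n\<close> has at most \<open>m\<close> ends, so at most one is
    selected there, and one is selected if it has exactly \<open>m\<close>.\<close>
  define W where "W = {a. a < r \<and> f a = n}"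
  note Imatch = partial_solution_matching[OF ps]
  have cU: "card U \<le> m" using Imatch(2) unfolding partial_matching_def by (auto split: if_splits)
  have "m * card W < m * 2" using numW(1) cU unfolding W_def by linarith
  then have cW: "card W \<le> 1" by simp
  have W0: "W \<noteq> {}" if "card U = m" using numW(2)[folded W_def] that m by (intro notI) simp
  obtain U' where U': "partial_matching ev (Suc r) (m - 1) (I \<union> {{r, a} | a. a \<in> W}) U'"
    and U'_old: "\<And>a. a < r \<Longrightarrow> of_bool (a \<in> U') + of_bool (a \<in> W) = (of_bool (a \<in> U) :: nat)"
    and U'_new: "of_bool (r \<in> U') + card W = of_bool ev"
    by (rule partial_matching_extend[OF Imatch(2,1) m1 W[folded W_def] cW W0]) (assumption | rule that)+
  have G: "\<And>c. c < n \<Longrightarrow> set (concat (G c)) \<subseteq> {..<r}"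
    and P: "\<And>c. c < n \<Longrightarrow> linear_forest ({..<r} - set (concat (G c))) (P c)"
    and cP: "\<And>c. c < n \<Longrightarrow> card (P c) \<le> m"
    and ends: "\<And>a. a < r \<Longrightarrow> (\<Sum>c<n. free_ends (P c) a) + of_bool (a \<in> U) = m"
    and total: "r + m = 2 * n + 1 + of_bool ev"
    and dis: "disjoint_family_on (colour_class n G P I) {..n}"
    and un: "(\<Union>c\<le>n. colour_class n G P I c) = complete_edges r"
    using ps unfolding partial_solution_def by auto
  define Q where "Q c P' \<longleftrightarrow> linear_forest (insert r ({..<r} - set (concat (G c)))) P' \<and>
      forest_edges P' = forest_edges (P c) \<union> (\<lambda>(p, b). {r, path_end p b}) ` S c \<and>
      card P' + card (S c) = card (P c) + 1 \<and> P' \<noteq> {} \<and>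
      (\<forall>a. a \<noteq> r \<longrightarrow> free_ends P' a + card {s \<in> S c. case_prod path_end s = a} = free_ends (P c) a) \<and>
      free_ends P' r + card (S c) = 2" for c P'
  have "\<exists>P'. Q c P'" if c: "c < n" for c
  proof -
    \<comment> \<open>At most \<open>m\<close> paths have at most \<open>2 * m\<close> ends, whose
      fair share is at most two.\<close>
    have "m * card (S c) < m * 3" using num[OF c] cP[OF c] by linarith
    then have c2: "card (S c) \<le> 2" by simp
    have rG: "r \<notin> {..<r} - set (concat (G c))" by simp
    show ?thesis unfolding Q_def
      by (rule linear_forest_attach_vertex[OF P[OF c] rG S[OF c] c2 inj[OF c m]]) blast
  qed
  then obtain P' where "\<And>c. c < n \<Longrightarrow> Q c (P' c)" by metis
  note P' = this[unfolded Q_def]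
  let ?I' = "I \<union> {{r, a} | a. a \<in> W}"
  have cc: "colour_class n G P' ?I' c = colour_class n G P I c \<union> {{r, a} | a. a < r \<and> f a = c}" if "c \<le> n" for c
    unfolding W_def by (rule colour_class_extend[OF that, of S]) (use bij P' in blast)+
  have "partial_solution ev n G (Suc r) (m - 1) P' ?I' U'"
    unfolding partial_solution_def
  proof (intro conjI allI impI)
    show "Suc r + (m - 1) = 2 * n + 1 + of_bool ev" using total m by simp
    show "partial_matching ev (Suc r) (m - 1) ?I' U'" by (rule U')
    show "disjoint_family_on (colour_class n G P' ?I') {..n}"
      using disjoint_family_extend(1)[OF dis un f] cc
      by (subst disjoint_family_on_cong[where B = "\<lambda>c. colour_class n G P I c \<union> {{r, a} | a. a < r \<and> f a = c}"]) auto
    show "(\<Union>c\<le>n. colour_class n G P' ?I' c) = complete_edges (Suc r)"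
      using disjoint_family_extend(2)[OF dis un f] cc by (simp cong: SUP_cong_simp)
    fix c assume c: "c < n"
    show "set (concat (G c)) \<subseteq> {..<Suc r}" using G[OF c] by (auto simp: less_Suc_eq)
    have "insert r ({..<r} - set (concat (G c))) = {..<Suc r} - set (concat (G c))" using G[OF c] by auto
    then show "linear_forest ({..<Suc r} - set (concat (G c))) (P' c)" using P'[OF c] by simp
    show "P' c \<noteq> {}" using P'[OF c] by simp
    \<comment> \<open>The number of paths changes by \<open>1 - card (S c)\<close>. With
      \<open>m\<close> paths two ends are selected, with \<open>m - 1\<close> paths at least one,
      and with fewer an increase by one is harmless.\<close>
    have "card (P c) < m - 1 \<or> card (P c) = m - 1 \<or> card (P c) = m" using cP[OF c] by linarith
    moreover have "card (S c) \<ge> 2" if "card (P c) = m"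
    proof -
      have "m * 1 < m * card (S c)" using num[OF c] that by linarith
      then show ?thesis by simp
    qed
    moreover have "card (S c) \<ge> 1" if "card (P c) = m - 1"
    proof (rule ccontr)
      assume "\<not> card (S c) \<ge> 1"
      then have "card (S c) = 0" by simp
      then show False using num[OF c] that m by simp
    qed
    ultimately show "card (P' c) \<le> m - 1" using P'[OF c] m by linarith
  next
    fix a assume a: "a < Suc r"
    show "(\<Sum>c<n. free_ends (P' c) a) + of_bool (a \<in> U') = m - 1"
    proof (cases "a = r")
      case False
      then have ar: "a < r" using a by simp
      \<comment> \<open>The single selected end at \<open>a\<close> has colour \<open>f a\<close>,
        so \<open>a\<close> loses one end in that colour and none elsewhere.\<close>
      have fib: "card {s \<in> S c. case_prod path_end s = a} = of_bool (f a = c)" if c: "c < n" for c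
      proof (cases "f a = c")
        case True
        then have "a \<in> case_prod path_end ` S c" using bij_betw_imp_surj_on[OF bij[OF c]] ar by simp
        then obtain s where s: "a = case_prod path_end s" "s \<in> S c" by (rule imageE)
        then have "{s \<in> S c. case_prod path_end s = a} = {s}"
          using inj_onD[OF bij_betw_imp_inj_on[OF bij[OF c]], of _ s] by blast
        then show ?thesis using True by simp
      next
        case False
        then have "a \<notin> case_prod path_end ` S c" using bij_betw_imp_surj_on[OF bij[OF c]] by simp
        then have "{s \<in> S c. case_prod path_end s = a} = {}" by blast
        then show ?thesis using False by (simp only: card.empty of_bool_eq)
      qed
      have "(\<Sum>c<n. free_ends (P c) a) = (\<Sum>c<n. free_ends (P' c) a + of_bool (f a = c))"
      proof (rule sum.cong)
        fix c assume "c \<in> {..<n}"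
        then have c: "c < n" by simp
        have "free_ends (P' c) a + card {s \<in> S c. case_prod path_end s = a} = free_ends (P c) a"
          using P'[OF c] False by blast
        then show "free_ends (P c) a = free_ends (P' c) a + of_bool (f a = c)" unfolding fib[OF c] by simp
      qed simp
      also have "\<dots> = (\<Sum>c<n. free_ends (P' c) a) + (\<Sum>c<n. of_bool (f a = c))" by (rule sum.distrib)
      also have "(\<Sum>c<n. of_bool (f a = c)) = (of_bool (f a < n) :: nat)" by (simp add: of_bool_def sum.delta)
      finally have "(\<Sum>c<n. free_ends (P' c) a) + of_bool (f a < n) + of_bool (a \<in> U) = m" using ends[OF ar] by simp
      moreover have "of_bool (f a < n) + of_bool (a \<in> W) = (1 :: nat)" using f[OF ar] ar by (auto simp: W_def)
      ultimately show ?thesis using U'_old[OF ar] by linarith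
    next
      case True
      \<comment> \<open>One end is selected at each of the \<open>r\<close> old vertices. Thus
        \<open>r\<close> uses up \<open>r\<close> of the \<open>2 * n + of_bool ev\<close> ends it
        would have without edges, which leaves \<open>m - 1\<close>.\<close>
      have "card {..<r} = card (\<Union>c\<le>n. {a. a < r \<and> f a = c})" using f by (intro arg_cong[where f = card]) auto
      also have "\<dots> = (\<Sum>c\<le>n. card {a. a < r \<and> f a = c})" by (rule card_UN_disjoint) auto
      also have "\<dots> = (\<Sum>c<n. card {a. a < r \<and> f a = c}) + card W"
        by (simp add: W_def lessThan_Suc_atMost[symmetric])
      also have "(\<Sum>c<n. card {a. a < r \<and> f a = c}) = (\<Sum>c<n. card (S c))"
        using bij_betw_same_card[OF bij] by (intro sum.cong) auto
      finally have "r = (\<Sum>c<n. card (S c)) + card W" by simp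
      moreover have "(\<Sum>c<n. free_ends (P' c) r + card (S c)) = (\<Sum>c<n. 2)"
        using P' by (intro sum.cong) simp_all
      then have "(\<Sum>c<n. free_ends (P' c) r) + (\<Sum>c<n. card (S c)) = 2 * n" by (simp add: sum.distrib)
      ultimately show ?thesis unfolding True using U'_new total by linarith
    qed
  qed
  then show thesis by (rule that)
qed

section \<open>Closing the paths to cycles\<close>

text \<open>With one vertex missing every forest is a single path, and fairness with
  \<open>m = 1\<close> selects every end. The last vertex is joined to both ends of each path and
  turns it into a cycle.\<close>

lemma partial_solution_finish:
  assumes ps: "partial_solution ev n G r 1 P I U"
  obtains K I' where "\<And>c. c < n \<Longrightarrow> distinct (K c) \<and> length (K c) \<ge> 3 \<and> set (K c) = {..<Suc r} - set (concat (G c))"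
    and "disjoint_family_on (\<lambda>c. if c < n then (\<Union>k\<in>set (K c # G c). cycle_edges k) else I') {..n}"
    and "(\<Union>c\<le>n. if c < n then (\<Union>k\<in>set (K c # G c). cycle_edges k) else I') = complete_edges (Suc r)"
    and "if ev then one_factor (Suc r) I' else I' = {}"
proof -
  obtain f S where f: "\<And>a. a < r \<Longrightarrow> f a \<le> n"
    and S: "\<And>c. c < n \<Longrightarrow> S c \<subseteq> P c \<times> UNIV"
    and bij: "\<And>c. c < n \<Longrightarrow> bij_betw (case_prod path_end) (S c) {a. a < r \<and> f a = c}"
    and num: "\<And>c. c < n \<Longrightarrow> 1 * card (S c) < 2 * card (P c) + 1 \<and> 2 * card (P c) < 1 * card (S c) + 1"
    and "\<And>c. c < n \<Longrightarrow> 1 \<ge> (2 :: nat) \<Longrightarrow> inj_on fst (S c)"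
    and W: "{a. a < r \<and> f a = n} \<subseteq> U"
    and numW: "1 * card {a. a < r \<and> f a = n} < card U + 1" "card U < 1 * card {a. a < r \<and> f a = n} + 1"
    by (rule partial_solution_selection[OF ps order_refl]) (rule that, assumption+)
  define W where "W = {a. a < r \<and> f a = n}"
  note Imatch = partial_solution_matching[OF ps]
  have cU: "card U \<le> 1" using Imatch(2) unfolding partial_matching_def by (auto split: if_splits)
  have cW: "card W \<le> 1" using numW(1) cU unfolding W_def by linarith
  have W0: "W \<noteq> {}" if "card U = 1" using numW(2)[folded W_def] that by (intro notI) simp
  let ?I' = "I \<union> {{r, a} | a. a \<in> W}"
  obtain U' where U': "partial_matching ev (Suc r) (1 - 1) ?I' U'"
    by (rule partial_matching_extend[OF Imatch(2,1) order_refl W[folded W_def] cW W0]) (assumption | rule that)+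
  have G: "\<And>c. c < n \<Longrightarrow> set (concat (G c)) \<subseteq> {..<r}"
    and P: "\<And>c. c < n \<Longrightarrow> linear_forest ({..<r} - set (concat (G c))) (P c) \<and> P c \<noteq> {} \<and> card (P c) \<le> 1"
    and dis: "disjoint_family_on (colour_class n G P I) {..n}"
    and un: "(\<Union>c\<le>n. colour_class n G P I c) = complete_edges r"
    using ps unfolding partial_solution_def by blast+
  have "\<exists>p. P c = {p}" if c: "c < n" for c
  proof -
    have "card (P c) = 1" using P[OF c] unfolding linear_forest_def by (metis card_0_eq le_antisym less_one not_less)
    then show ?thesis by (meson card_1_singletonE)
  qed
  then obtain p where p: "\<And>c. c < n \<Longrightarrow> P c = {p c}" by metis
  have pc: "p c \<noteq> []" "distinct (p c)" "set (p c) = {..<r} - set (concat (G c))" if "c < n" for c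
    using P[OF that] p[OF that] by (auto simp: linear_forest_def)
  have Sc: "S c = {(p c, True), (p c, False)}" if c: "c < n" for c
  proof -
    have "S c \<subseteq> {(p c, True), (p c, False)}"
    proof
      fix s assume "s \<in> S c"
      then have "fst s = p c" using S[OF c] p[OF c] by auto
      then show "s \<in> {(p c, True), (p c, False)}" by (cases s) auto
    qed
    moreover have "card (S c) \<ge> 2" using num[OF c] p[OF c] by simp
    ultimately show ?thesis by (intro card_seteq) auto
  qed
  \<comment> \<open>Only one end is selected at each vertex, so the two ends of the path are
    different vertices; this makes the closed cycle have length at least 3.\<close>
  have ends: "hd (p c) \<noteq> last (p c)" if c: "c < n" for c
    using bij_betw_imp_inj_on[OF bij[OF c]] unfolding Sc[OF c] by (auto simp: inj_on_def path_end_def)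
  define K where "K c = p c @ [r]" for c
  have cc: "(if c < n then (\<Union>k\<in>set (K c # G c). cycle_edges k) else ?I') =
      colour_class n G P I c \<union> {{r, a} | a. a < r \<and> f a = c}" if cn: "c \<le> n" for c
  proof (cases "c < n")
    case c: True
    have "{{r, a} | a. a < r \<and> f a = c} = (\<lambda>a. {r, a}) ` case_prod path_end ` S c"
      unfolding bij_betw_imp_surj_on[OF bij[OF c]] by auto
    also have "\<dots> = {{r, hd (p c)}, {r, last (p c)}}" unfolding Sc[OF c] by (auto simp: path_end_def)
    finally have new: "{{r, a} | a. a < r \<and> f a = c} = {{r, hd (p c)}, {r, last (p c)}}" .
    have "cycle_edges (K c) = {{r, hd (p c)}, {r, last (p c)}} \<union> path_edges (p c)"
      using pc[OF c] by (simp add: K_def cycle_edges_path_edges path_edges_append insert_commute)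
    then show ?thesis unfolding new using c p[OF c] by (auto simp: colour_class_def forest_edges_def)
  next
    case False
    then show ?thesis using cn by (auto simp: colour_class_def W_def)
  qed
  show thesis
  proof (rule that[of K ?I'])
    fix c assume c: "c < n"
    have "length (p c) \<ge> 2" using pc(1)[OF c] ends[OF c] by (cases "p c"; cases "tl (p c)") auto
    then show "distinct (K c) \<and> length (K c) \<ge> 3 \<and> set (K c) = {..<Suc r} - set (concat (G c))"
      using pc[OF c] G[OF c] by (auto simp: K_def)
  next
    show "disjoint_family_on (\<lambda>c. if c < n then (\<Union>k\<in>set (K c # G c). cycle_edges k) else ?I') {..n}"
      using disjoint_family_extend(1)[OF dis un f] cc
      by (subst disjoint_family_on_cong[where B = "\<lambda>c. colour_class n G P I c \<union> {{r, a} | a. a < r \<and> f a = c}"]) auto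
    have "(\<Union>c\<le>n. if c < n then (\<Union>k\<in>set (K c # G c). cycle_edges k) else ?I') =
        (\<Union>c\<le>n. colour_class n G P I c \<union> {{r, a} | a. a < r \<and> f a = c})" using cc by (intro SUP_cong) auto
    then show un': "(\<Union>c\<le>n. if c < n then (\<Union>k\<in>set (K c # G c). cycle_edges k) else ?I') = complete_edges (Suc r)"
      using disjoint_family_extend(2)[OF dis un f] by simp
    \<comment> \<open>No vertex is missing any more, so \<open>card U'\<close> is bounded by 0 and
      the matching covers everything.\<close>
    have "U' = {}" if ev
      using U' that unfolding partial_matching_def by (auto simp: finite_subset)
    moreover have "?I' \<subseteq> complete_edges (Suc r)"
      unfolding un'[symmetric] using UN_upper[of n "{..n}"] by auto
    ultimately show "if ev then one_factor (Suc r) ?I' else ?I' = {}"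
      using U' unfolding partial_matching_def one_factor_def by (auto split: if_splits)
  qed
qed

lemma partial_solution_reach_one:
  assumes "partial_solution ev n G r m P I U" and "m \<ge> 1"
  shows "\<exists>P I U. partial_solution ev n G (r + m - 1) 1 P I U"
  using assms
proof (induction m arbitrary: r P I U)
  case (Suc m)
  show ?case
  proof (cases "m = 0")
    case True
    then show ?thesis using Suc.prems by auto
  next
    case False
    then have "Suc m \<ge> 2" by simp
    from partial_solution_step[OF Suc.prems(1) this] obtain P' I' U'
      where "partial_solution ev n G (Suc r) m P' I' U'" by auto
    then show ?thesis using Suc.IH[of "Suc r"] False by auto
  qed
qed simp

text \<open>Each forest ends up as one cycle through all vertices outside the small cycles of its
  colour, which forces its length. The bound on \<open>sum_mset M\<close> keeps the subtraction
  exact.\<close>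

lemma partial_solution_imp_OP_solvable:
  assumes ps: "partial_solution ev n G r m P I U" and m: "m \<ge> 1"
    and G: "\<And>c. c < n \<Longrightarrow> mset (map length (G c)) = M \<and> (\<forall>k\<in>set (G c). length k \<ge> 3) \<and> distinct (concat (G c))"
    and M: "sum_mset M \<le> r"
  shows "OP_solvable ({#r + m - sum_mset M#} + M)"
proof -
  define r' where "r' = r + m - 1"
  have r': "Suc r' = r + m" using m by (simp add: r'_def)
  obtain P' I' U' where ps': "partial_solution ev n G r' 1 P' I' U'"
    using partial_solution_reach_one[OF ps m] unfolding r'_def by blast
  obtain K J where K: "\<And>c. c < n \<Longrightarrow> distinct (K c) \<and> length (K c) \<ge> 3 \<and> set (K c) = {..<Suc r'} - set (concat (G c))"
    and dis: "disjoint_family_on (\<lambda>c. if c < n then (\<Union>k\<in>set (K c # G c). cycle_edges k) else J) {..n}"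
    and un: "(\<Union>c\<le>n. if c < n then (\<Union>k\<in>set (K c # G c). cycle_edges k) else J) = complete_edges (Suc r')"
    and J: "if ev then one_factor (Suc r') J else J = {}"
    by (rule partial_solution_finish[OF ps']) (rule that, assumption+)
  define H where "H c = (\<Union>k\<in>set (K c # G c). cycle_edges k)" for c
  have v: "sum_mset ({#r + m - sum_mset M#} + M) = Suc r'" using M r' by simp
  have "even (Suc r') \<longleftrightarrow> ev" using ps' unfolding partial_solution_def by auto
  then have J': "if even (Suc r') then one_factor (Suc r') J else J = {}" using J by simp
  have dis': "H c \<inter> H c' = {}" if "c < n" "c' < n" "c \<noteq> c'" for c c'
    using disjoint_family_onD[OF dis, of c c'] that by (simp add: H_def)
  have disJ: "H c \<inter> J = {}" if "c < n" for c
    using disjoint_family_onD[OF dis, of c n] that by (simp add: H_def)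
  have "complete_edges (Suc r') = (\<Union>c<n. H c) \<union> J"
    unfolding un[symmetric] lessThan_Suc_atMost[symmetric] lessThan_Suc by (auto simp: H_def)
  then have un': "\<Union>(H ` {..<n}) = complete_edges (Suc r') - J" using disJ by auto
  have G_sub: "set (concat (G c)) \<subseteq> {..<Suc r'}" if "c < n" for c
    using ps' that unfolding partial_solution_def by fastforce
  have type: "two_factor_of_type (Suc r') ({#r + m - sum_mset M#} + M) (H c)" if c: "c < n" for c
    unfolding two_factor_of_type_def
  proof (intro exI[of _ "K c # G c"] conjI)
    have "length (K c) = card (set (K c))" using K[OF c] distinct_card by metis
    also have "\<dots> = Suc r' - card (set (concat (G c)))"
      using K[OF c] G_sub[OF c] by (simp add: card_Diff_subset del: set_concat)
    also have "card (set (concat (G c))) = length (concat (G c))" using G[OF c] by (intro distinct_card) blast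
    also have "\<dots> = sum_mset M" using G[OF c] by (metis length_concat sum_mset_sum_list)
    finally show "mset (map length (K c # G c)) = {#r + m - sum_mset M#} + M" using G[OF c] r' by simp
    show "\<forall>k\<in>set (K c # G c). length k \<ge> 3" using K[OF c] G[OF c] by auto
    show "distinct (concat (K c # G c))" using K[OF c] G[OF c] by auto
    show "set (concat (K c # G c)) = {0..<Suc r'}" using K[OF c] G_sub[OF c] by auto
    show "H c = (\<Union>k\<in>set (K c # G c). cycle_edges k)" by (simp add: H_def)
  qed
  show ?thesis unfolding OP_solvable_def v Let_def
  proof (intro exI[of _ J] exI[of _ "H ` {..<n}"] conjI ballI impI)
    show "A \<inter> B = {}" if "A \<in> H ` {..<n}" "B \<in> H ` {..<n}" "A \<noteq> B" for A B using that dis' by auto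
    show "two_factor_of_type (Suc r') ({#r + m - sum_mset M#} + M) F" if "F \<in> H ` {..<n}" for F
      using that type by auto
  qed (use J' un' in auto)
qed

section \<open>The given solution\<close>

lemma cycle_edges_rotate: "p \<noteq> [] \<Longrightarrow> q \<noteq> [] \<Longrightarrow> cycle_edges (p @ q) = cycle_edges (q @ p)"
  by (auto simp: cycle_edges_path_edges path_edges_append)

text \<open>After rotating \<open>a\<close> to the front, its edges are the first one and the
  closing one, which differ because the length is at least 3.\<close>

lemma card_cycle_edges_at:
  assumes "distinct c" and "length c \<ge> 3" and "a \<in> set c"
  shows "card {e \<in> cycle_edges c. a \<in> e} = 2"
proof -
  obtain p q where c: "c = p @ a # q" using assms(3) by (meson split_list)
  have rot: "cycle_edges c = cycle_edges (a # q @ p)" using c cycle_edges_rotate[of p "a # q"] by (cases "p = []") auto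
  obtain b s where bs: "q @ p = b # s" using assms(2) c by (cases "q @ p") auto
  have s: "s \<noteq> []" using assms(2) c arg_cong[OF bs, of length] by auto
  have d: "distinct (a # b # s)" using assms(1) c bs[symmetric] by auto
  have "cycle_edges c = {{last s, a}, {a, b}} \<union> path_edges (b # s)"
    unfolding rot bs using s by (simp add: cycle_edges_path_edges)
  moreover have "a \<notin> e" if "e \<in> path_edges (b # s)" for e using path_edges_subset[OF that] d by auto
  ultimately have "{e \<in> cycle_edges c. a \<in> e} = {{last s, a}, {a, b}}" by auto
  moreover have "last s \<noteq> b" using s d by auto
  then have "{last s, a} \<noteq> {a, b}" by (auto simp: doubleton_eq_iff)
  ultimately show ?thesis by simp
qed

lemma card_two_factor_edges_at:
  assumes "two_factor_of_type v M H" and "a < v"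
  shows "card {e \<in> H. a \<in> e} = 2"
proof -
  obtain cs where cs: "\<forall>c \<in> set cs. length c \<ge> 3" "distinct (concat cs)" "set (concat cs) = {0..<v}"
    "H = (\<Union>c \<in> set cs. cycle_edges c)"
    using assms(1) unfolding two_factor_of_type_def by blast
  have "a \<in> set (concat cs)" using cs(3) assms(2) by simp
  then obtain c where c: "c \<in> set cs" "a \<in> set c" by auto
  have "a \<notin> set c'" if "c' \<in> set cs" "c' \<noteq> c" for c'
    using cs(2) c that by (auto simp: distinct_concat_iff)
  then have "{e \<in> H. a \<in> e} = {e \<in> cycle_edges c. a \<in> e}"
    unfolding cs(4) using c cycle_edges_subset by blast
  moreover have "distinct c" using cs(2) c by (auto simp: distinct_concat_iff)
  ultimately show ?thesis using card_cycle_edges_at c cs(1) by simp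
qed

lemma finite_complete_edges: "finite (complete_edges v)"
proof -
  have "complete_edges v \<subseteq> Pow {..<v}" by (auto simp: complete_edges_def)
  then show ?thesis by (rule finite_subset) simp
qed

lemma card_complete_edges_at: "a < v \<Longrightarrow> card {e \<in> complete_edges v. a \<in> e} = v - 1"
proof -
  assume a: "a < v"
  have "{e \<in> complete_edges v. a \<in> e} = (\<lambda>b. {a, b}) ` ({..<v} - {a})"
    using a by (auto simp: complete_edges_def)
  moreover have "inj_on (\<lambda>b. {a, b}) ({..<v} - {a})" by (auto simp: inj_on_def doubleton_eq_iff)
  ultimately show ?thesis using a by (simp add: card_image)
qed

text \<open>Counts the \<open>v - 1\<close> edges at vertex 0: two in each 2-factor and, for even
  \<open>v\<close>, one in the 1-factor.\<close>

lemma card_two_factorisation: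
  assumes v: "v > 0" and D: "\<forall>A\<in>D. \<forall>B\<in>D. A \<noteq> B \<longrightarrow> A \<inter> B = {}" "\<Union>D = complete_edges v - I"
    "\<forall>H\<in>D. two_factor_of_type v M H" and I: "if even v then one_factor v I else I = {}"
  shows "finite D" and "2 * card D + 1 + of_bool (even v) = v"
proof -
  have finD: "finite (\<Union>D)" using D(2) finite_complete_edges by simp
  then show "finite D" using finite_UnionD by blast
  have "card {e \<in> complete_edges v - I. 0 \<in> e} = card (\<Union>H\<in>D. {e \<in> H. 0 \<in> e})"
    unfolding D(2)[symmetric] by (intro arg_cong[where f = card]) auto
  also have "\<dots> = (\<Sum>H\<in>D. card {e \<in> H. 0 \<in> e})"
  proof (rule card_UN_disjoint[OF \<open>finite D\<close>])
    show "\<forall>H\<in>D. finite {e \<in> H. 0 \<in> e}" using finD by (auto intro: finite_subset)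
    show "\<forall>A\<in>D. \<forall>B\<in>D. A \<noteq> B \<longrightarrow> {e \<in> A. 0 \<in> e} \<inter> {e \<in> B. 0 \<in> e} = {}" using D(1) by blast
  qed
  also have "\<dots> = (\<Sum>H\<in>D. 2)" using card_two_factor_edges_at v D(3) by (intro sum.cong) auto
  finally have deg: "card {e \<in> complete_edges v - I. 0 \<in> e} = 2 * card D" by simp
  have all: "card {e \<in> complete_edges v. 0 \<in> e} = v - 1" using card_complete_edges_at v by simp
  show "2 * card D + 1 + of_bool (even v) = v"
  proof (cases "even v")
    case True
    then have I': "I \<subseteq> complete_edges v" "\<exists>!e. e \<in> I \<and> 0 \<in> e" using I v by (auto simp: one_factor_def)
    then obtain e where "{e \<in> I. 0 \<in> e} = {e}" by blast
    then have "card {e \<in> I. 0 \<in> e} = 1" by simp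
    moreover have "{e \<in> complete_edges v - I. 0 \<in> e} = {e \<in> complete_edges v. 0 \<in> e} - {e \<in> I. 0 \<in> e}" by auto
    then have "card {e \<in> complete_edges v - I. 0 \<in> e} = card {e \<in> complete_edges v. 0 \<in> e} - card {e \<in> I. 0 \<in> e}"
      using I'(1) finite_complete_edges[of v] by (simp, intro card_Diff_subset) (auto intro: finite_subset)
    moreover have "v \<ge> 2" using True v by auto
    ultimately show ?thesis using deg all True by simp
  next
    case False
    then show ?thesis using I deg all v by simp
  qed
qed

section \<open>Splitting a 2-factor into its x-cycle and the copies of the small cycles\<close>

text \<open>Used with \<open>f = length\<close> to group the small cycles into copies; one preimage
  of \<open>M\<close> is peeled off at a time.\<close>

lemma image_mset_eq_repeat_mset:
  assumes "image_mset f A = repeat_mset \<mu> M"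
  shows "\<exists>g. (\<forall>j<\<mu>. image_mset f (g j) = M) \<and> A = (\<Sum>j<\<mu>. g j)"
  using assms
proof (induction \<mu> arbitrary: A)
  case (Suc \<mu>)
  then have "image_mset f A = repeat_mset \<mu> M + M" by (simp add: union_commute)
  from image_mset_eq_plusD[OF this] obtain B C where BC: "A = B + C" "image_mset f B = repeat_mset \<mu> M" "image_mset f C = M"
    by metis
  from Suc.IH[OF BC(2)] obtain g where g: "\<forall>j<\<mu>. image_mset f (g j) = M" "B = (\<Sum>j<\<mu>. g j)" by blast
  show ?case using g BC by (intro exI[of _ "g(\<mu> := C)"]) (auto simp: less_Suc_eq)
qed simp

text \<open>\<open>k\<close> is the x-cycle of the factor and \<open>g j\<close> its copy number
  \<open>j\<close> of the small cycles.\<close>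

definition factor_parts ::
    "nat \<Rightarrow> nat \<Rightarrow> nat \<Rightarrow> nat multiset \<Rightarrow> nat set set \<Rightarrow> nat list \<Rightarrow> (nat \<Rightarrow> nat list list) \<Rightarrow> bool" where
  "factor_parts v x \<mu> M H k g \<longleftrightarrow> length k = x \<and> distinct k \<and>
     (\<forall>j<\<mu>. mset (map length (g j)) = M \<and> (\<forall>c\<in>set (g j). length c \<ge> 3) \<and> distinct (concat (g j)) \<and>
        set k \<inter> set (concat (g j)) = {}) \<and>
     (\<forall>i<\<mu>. \<forall>j<\<mu>. i \<noteq> j \<longrightarrow> set (concat (g i)) \<inter> set (concat (g j)) = {}) \<and>
     set k \<union> (\<Union>j<\<mu>. set (concat (g j))) = {..<v} \<and>
     H = cycle_edges k \<union> (\<Union>j<\<mu>. \<Union>c\<in>set (g j). cycle_edges c)"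

lemma two_factor_split:
  assumes "two_factor_of_type v ({#x#} + repeat_mset \<mu> M) H"
  shows "\<exists>k g. factor_parts v x \<mu> M H k g"
proof -
  obtain cs where cs: "mset (map length cs) = {#x#} + repeat_mset \<mu> M" "\<forall>c \<in> set cs. length c \<ge> 3"
    "distinct (concat cs)" "set (concat cs) = {0..<v}" "H = (\<Union>c \<in> set cs. cycle_edges c)"
    using assms unfolding two_factor_of_type_def by blast
  have "image_mset length (mset cs) = {#x#} + repeat_mset \<mu> M" using cs(1) by simp
  from image_mset_eq_plusD[OF this] obtain B C where BC: "mset cs = B + C" "image_mset length B = {#x#}" "image_mset length C = repeat_mset \<mu> M"
    by metis
  have "size B = 1" using arg_cong[OF BC(2), of size] by simp
  then obtain k where kB: "B = {#k#}" using size_1_singleton_mset by blast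
  then have k: "B = {#k#}" "length k = x" using BC(2) by auto
  obtain h where h: "\<forall>j<\<mu>. image_mset length (h j) = M" "C = (\<Sum>j<\<mu>. h j)"
    using image_mset_eq_repeat_mset[OF BC(3)] by blast
  have "\<forall>j. \<exists>xs. mset xs = h j" using ex_mset by blast
  from choice[OF this] obtain g where g: "\<And>j. mset (g j) = h j" by blast
  \<comment> \<open>Reorders \<open>cs\<close> with the x-cycle first and the copies one after
    another; a permutation preserves distinctness and the vertex set.\<close>
  define ds where "ds = k # concat (map g [0..<\<mu>])"
  have "mset (concat (map g [0..<\<mu>])) = C"
    unfolding h(2) by (simp add: mset_concat comp_def g interv_sum_list_conv_sum_set_nat atLeast0LessThan)
  then have ds: "mset ds = mset cs" using BC(1) k by (simp add: ds_def)
  then have set_ds: "set ds = set cs" by (metis set_mset_mset)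
  have "mset (concat ds) = mset (concat cs)" using ds by (metis mset_concat mset_map sum_mset_sum_list)
  then have dist: "distinct (concat ds)" "set (concat ds) = {0..<v}"
    using cs(3,4) by (metis mset_eq_imp_distinct_iff, metis mset_eq_setD)
  have conc: "concat ds = k @ concat (map (concat \<circ> g) [0..<\<mu>])"
  proof -
    have "concat (concat yss) = concat (map concat yss)" for yss :: "nat list list list" by (induction yss) auto
    then show ?thesis by (simp add: ds_def)
  qed
  have set_ds': "set ds = insert k (\<Union>j<\<mu>. set (g j))" by (auto simp: ds_def)
  show ?thesis unfolding factor_parts_def
  proof (intro exI[of _ k] exI[of _ g] conjI allI impI)
    show "length k = x" by (rule k(2))
    show "mset (map length (g j)) = M" if "j < \<mu>" for j using h(1) g that by simp
    show "\<forall>c\<in>set (g j). length c \<ge> 3" if "j < \<mu>" for j using cs(2) set_ds set_ds' that by blast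
    show "distinct k" using dist(1) conc by simp
    show "distinct (concat (g j))" if "j < \<mu>" for j
    proof -
      have "distinct (concat (map (concat \<circ> g) [0..<\<mu>]))" using dist(1) conc by simp
      then have "\<forall>ys. ys \<in> set (map (concat \<circ> g) [0..<\<mu>]) \<longrightarrow> distinct ys"
        unfolding distinct_concat_iff by blast
      moreover have "concat (g j) \<in> set (map (concat \<circ> g) [0..<\<mu>])" using that by auto
      ultimately show ?thesis by blast
    qed
    show "set k \<inter> set (concat (g j)) = {}" if "j < \<mu>" for j
    proof -
      have "set k \<inter> (\<Union>j<\<mu>. set (concat (g j))) = {}" using dist(1) unfolding conc by (simp add: atLeast0LessThan)
      then show ?thesis using that by blast
    qed
    show "set k \<union> (\<Union>j<\<mu>. set (concat (g j))) = {..<v}"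
      using dist(2) unfolding conc by (simp add: atLeast0LessThan)
    show "H = cycle_edges k \<union> (\<Union>j<\<mu>. \<Union>c\<in>set (g j). cycle_edges c)"
      unfolding cs(5) set_ds[symmetric] set_ds' by auto
    have "set (concat (g i)) \<inter> set (concat (g j)) = {}" if "i < j" "j < \<mu>" for i j
    proof -
      have "[0..<\<mu>] = [0..<j] @ [j..<\<mu>]"
        using that upt_add_eq_append[of 0 j "\<mu> - j"] by simp
      then have "distinct (concat (map (concat \<circ> g) [0..<j]) @ concat (map (concat \<circ> g) [j..<\<mu>]))"
        using dist(1) unfolding conc by simp
      then have "(\<Union>i<j. set (concat (g i))) \<inter> (\<Union>i\<in>{j..<\<mu>}. set (concat (g i))) = {}" by (simp add: atLeast0LessThan)
      moreover have "i \<in> {..<j}" "j \<in> {j..<\<mu>}" using that by auto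
      ultimately show ?thesis by blast
    qed
    then show "set (concat (g i)) \<inter> set (concat (g j)) = {}" if "i < \<mu>" "j < \<mu>" "i \<noteq> j" for i j
      using that by (metis Int_commute nat_neq_iff)
  qed
qed

section \<open>The initial forests\<close>

text \<open>The starting forest of a colour: its piece \<open>Q\<close> of the x-cycle, with every
  other vertex outside its small cycles isolated.\<close>

lemma linear_forest_path_and_points:
  assumes X: "finite X" and Q: "distinct Q" "Q \<noteq> []" "set Q \<subseteq> X"
  defines "P \<equiv> insert Q ((\<lambda>a. [a]) ` (X - set Q))"
  shows "linear_forest X P" and "forest_edges P = path_edges Q" and "card P \<le> card X"
    and "free_ends P a = (if a \<in> set Q then of_bool (hd Q = a) + of_bool (last Q = a) else if a \<in> X then 2 else 0)"
proof -
  have Qn: "Q \<notin> (\<lambda>a. [a]) ` (X - set Q)" by auto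
  have fin: "finite (X - set Q)" using X by simp
  show "linear_forest X P" unfolding linear_forest_def P_def using X Q by auto
  show "forest_edges P = path_edges Q" by (auto simp: forest_edges_def P_def)
  have "card P = card (X - set Q) + 1" unfolding P_def using Qn fin by (simp add: card_image inj_on_def)
  also have "\<dots> \<le> card X" using psubset_card_mono[OF X, of "X - set Q"] Q hd_in_set[of Q] by fastforce
  finally show "card P \<le> card X" .
  have "free_ends P a = of_bool (hd Q = a) + of_bool (last Q = a) + (\<Sum>b\<in>X - set Q. of_bool (b = a) + of_bool (b = a))"
    unfolding free_ends_def P_def using Qn fin by (simp add: sum.reindex inj_on_def)
  also have "(\<Sum>b\<in>X - set Q. of_bool (b = a) + of_bool (b = a)) = (if a \<in> X - set Q then 2 else 0 :: nat)"
  proof -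
    have "(\<Sum>b\<in>X - set Q. of_bool (b = a) + of_bool (b = a)) = (\<Sum>b\<in>X - set Q. if b = a then 2 else 0 :: nat)"
      by (intro sum.cong) auto
    then show ?thesis using fin by (simp add: sum.delta')
  qed
  finally show "free_ends P a = (if a \<in> set Q then of_bool (hd Q = a) + of_bool (last Q = a) else if a \<in> X then 2 else 0)"
    using Q hd_in_set[of Q] last_in_set[of Q] by auto
qed

text \<open>The only path edge at \<open>hd k\<close> is the first one, and its other end is not
  \<open>last k\<close> since there are at least three vertices.\<close>

lemma closing_edge_notin_path_edges:
  assumes "distinct k" and "length k \<ge> 3"
  shows "{last k, hd k} \<notin> path_edges k"
proof -
  obtain a b p where k: "k = a # b # p" "p \<noteq> []" using assms(2) by (cases k; cases "tl k"; cases "tl (tl k)") auto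
  have "{last k, hd k} \<noteq> {a, b}" using k assms(1) by (auto simp: doubleton_eq_iff)
  moreover have "{last k, hd k} \<notin> path_edges (b # p)"
    using path_edges_subset[of "{last k, hd k}" "b # p"] k assms(1) by auto
  ultimately show ?thesis using k by simp
qed

lemma union_cycle_edges_subset:
  assumes "e \<in> (\<Union>c\<in>set cs. cycle_edges c)"
  shows "e \<subseteq> set (concat cs)" and "e \<noteq> {}"
proof -
  obtain c where c: "c \<in> set cs" "e \<in> cycle_edges c" using assms by blast
  then show "e \<subseteq> set (concat cs)" using cycle_edges_subset[OF c(2)] by auto
  show "e \<noteq> {}" using c(2) by (auto simp: cycle_edges_def)
qed

lemma mult_add_less: "i < w \<Longrightarrow> j < \<mu> \<Longrightarrow> i * \<mu> + j < w * (\<mu> :: nat)"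
proof -
  assume "i < w" "j < \<mu>"
  then have "i * \<mu> + j < Suc i * \<mu>" by simp
  also have "\<dots> \<le> w * \<mu>" using \<open>i < w\<close> by (intro mult_le_mono1) simp
  finally show ?thesis .
qed

text \<open>Copy \<open>j\<close> in factor \<open>i\<close> has colour number
  \<open>i * \<mu> + j\<close>; this regroups a sum over colours by factors.\<close>

lemma sum_div_mod:
  fixes F :: "nat \<Rightarrow> nat \<Rightarrow> nat"
  assumes "\<mu> > 0"
  shows "(\<Sum>c<w * \<mu>. F (c div \<mu>) (c mod \<mu>)) = (\<Sum>i<w. \<Sum>j<\<mu>. F i j)"
proof -
  have "(\<Sum>i<w. \<Sum>j<\<mu>. F i j) = (\<Sum>(i, j)\<in>{..<w} \<times> {..<\<mu>}. F i j)" by (simp add: sum.cartesian_product)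
  also have "\<dots> = (\<Sum>c<w * \<mu>. F (c div \<mu>) (c mod \<mu>))"
    by (rule sum.reindex_bij_witness[where j = "\<lambda>(i, j). i * \<mu> + j" and i = "\<lambda>c. (c div \<mu>, c mod \<mu>)"])
      (use assms in \<open>auto simp: less_mult_imp_div_less mult_add_less\<close>)
  finally show ?thesis by simp
qed

text \<open>How the edges of the \<open>x\<close>-cycle \<open>k\<close> of a 2-factor are distributed over its \<open>\<mu>\<close> colours: all but the
  closing edge go to colour 0, the closing edge goes to colour 1. In the other colours the trivial
  path merely keeps the description uniform.\<close>

definition start_path :: "nat list \<Rightarrow> nat \<Rightarrow> nat list" where
  "start_path k j = (if j = 0 then k else if j = 1 then [last k, hd k] else [hd k])"

lemma start_path:
  assumes "distinct k" and "length k \<ge> 3"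
  shows "distinct (start_path k j)" "start_path k j \<noteq> []" "set (start_path k j) \<subseteq> set k"
proof -
  have k: "k \<noteq> []" using assms(2) by auto
  have "last k \<noteq> hd k" using assms by (cases k) (auto split: if_splits)
  then show "distinct (start_path k j)" "start_path k j \<noteq> []" "set (start_path k j) \<subseteq> set k"
    using assms k by (auto simp: start_path_def)
qed

lemma start_path_edges:
  assumes "distinct k" and "length k \<ge> 3" and "\<mu> \<ge> 2"
  shows "(\<Union>j<\<mu>. path_edges (start_path k j)) = cycle_edges k"
    and "i \<noteq> j \<Longrightarrow> path_edges (start_path k i) \<inter> path_edges (start_path k j) = {}"
proof -
  have "(\<Union>j<\<mu>. path_edges (start_path k j)) = path_edges k \<union> {{last k, hd k}}"
  proof -
    have "{..<\<mu>} = insert 0 (insert 1 {2..<\<mu>})" using assms(3) by auto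
    moreover have "(\<Union>j\<in>{2..<\<mu>}. path_edges (start_path k j)) = {}" by (auto simp: start_path_def)
    ultimately show ?thesis by (simp add: start_path_def)
  qed
  then show "(\<Union>j<\<mu>. path_edges (start_path k j)) = cycle_edges k"
    using assms(2) by (subst cycle_edges_path_edges) auto
  show "path_edges (start_path k i) \<inter> path_edges (start_path k j) = {}" if "i \<noteq> j"
    using that closing_edge_notin_path_edges[OF assms(1,2)] by (auto simp: start_path_def)
qed

text \<open>The value 2 stands for an isolated vertex. Colours 0 and 1 together leave two ends at
  \<open>a\<close>: one each if \<open>a\<close> is an end of the path \<open>k\<close>, otherwise
  none and two. Each of the other \<open>\<mu> - 2\<close> colours leaves two.\<close>

lemma sum_start_free_ends:
  assumes k: "distinct k" "length k \<ge> 3" and \<mu>: "\<mu> \<ge> 2" and a: "a \<in> set k"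
  shows "(\<Sum>j<\<mu>. if a \<in> set (start_path k j) then of_bool (hd (start_path k j) = a) + of_bool (last (start_path k j) = a) else 2)
    = 2 * (\<mu> - 1)" (is "sum ?F _ = _")
proof -
  have "last k \<noteq> hd k" using k by (cases k) (auto split: if_splits)
  have "{..<\<mu>} = insert 0 (insert 1 {2..<\<mu>})" using \<mu> by auto
  then have "sum ?F {..<\<mu>} = ?F 0 + ?F 1 + sum ?F {2..<\<mu>}" by simp
  also have "sum ?F {2..<\<mu>} = (\<Sum>j=2..<\<mu>. 2)" by (intro sum.cong) (auto simp: start_path_def)
  also have "?F 0 + ?F 1 = 2" using a \<open>last k \<noteq> hd k\<close> by (auto simp: start_path_def)
  finally show ?thesis using \<mu> by simp
qed

theorem theorem4p1:
  fixes \<mu> u x w \<epsilon> :: nat and ls :: "nat list"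
  assumes "\<mu> \<ge> 1" and "u \<ge> 1" and "x \<ge> 3"
    and "length ls = u" and "\<forall>l \<in> set ls. l \<ge> 3"
    and "w \<ge> 1" and "\<epsilon> \<in> {1, 2}"
    and "x + \<mu> * sum_list ls = 2 * w + \<epsilon>"
    and "OP_solvable ({#x#} + repeat_mset \<mu> (mset ls))"
  shows "OP_solvable ({#2 * w * \<mu> + \<epsilon> - sum_list ls#} + mset ls)"
proof (cases "\<mu> = 1")
  \<comment> \<open>With a single copy the new long cycle has length \<open>x\<close>, so the
    hypothesis is the claim.\<close>
  case True
  then have "2 * w * \<mu> + \<epsilon> - sum_list ls = x" using assms(8) by simp
  then show ?thesis using assms(9) True by simp
next
  case False
  then have \<mu>: "\<mu> \<ge> 2" using assms(1) by simp
  define v where "v = 2 * w + \<epsilon>"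
  have sum_repeat: "sum_mset (repeat_mset \<mu> (mset ls)) = \<mu> * sum_list ls"
    by (induction \<mu>) (auto simp: sum_mset_sum_list)
  have v_sum: "sum_mset ({#x#} + repeat_mset \<mu> (mset ls)) = v" using assms(8) by (simp add: sum_repeat v_def)
  have ev: "even v \<longleftrightarrow> \<epsilon> = 2" using assms(7) by (auto simp: v_def)
  have v0: "v > 0" using assms(6) by (simp add: v_def)
  obtain I D where I: "if even v then one_factor v I else I = {}"
    and D: "\<forall>A\<in>D. \<forall>B\<in>D. A \<noteq> B \<longrightarrow> A \<inter> B = {}" "\<Union>D = complete_edges v - I"
      "\<forall>H\<in>D. two_factor_of_type v ({#x#} + repeat_mset \<mu> (mset ls)) H"
    using assms(9) unfolding OP_solvable_def v_sum Let_def by blast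
  have "2 * card D + 1 + of_bool (even v) = v" "finite D" using card_two_factorisation[OF v0 D I] by auto
  \<comment> \<open>The parity of \<open>v\<close> is that of \<epsilon>, so
    \<open>\<epsilon> = 1 + of_bool (even v)\<close>.\<close>
  then have "card D = w" using assms(7) by (auto simp: v_def)
  then obtain H where H: "bij_betw H {0..<w} D" using ex_bij_betw_nat_finite[OF \<open>finite D\<close>] by auto
  then have H_D: "\<And>i. i < w \<Longrightarrow> H i \<in> D" by (auto simp: bij_betw_def)
  have "\<exists>k g. factor_parts v x \<mu> (mset ls) (H i) k g" if i: "i < w" for i
    using two_factor_split D(3) H_D[OF i] by blast
  then obtain k g where "\<And>i. i < w \<Longrightarrow> factor_parts v x \<mu> (mset ls) (H i) (k i) (g i)" by metis
  note kg = this[unfolded factor_parts_def]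
  have k: "length (k i) = x" "distinct (k i)" "length (k i) \<ge> 3" if "i < w" for i using kg[OF that] assms(3) by auto
  have g: "mset (map length (g i j)) = mset ls" "\<forall>c\<in>set (g i j). length c \<ge> 3" "distinct (concat (g i j))"
    "set (k i) \<inter> set (concat (g i j)) = {}" if "i < w" "j < \<mu>" for i j
    using kg[THEN conjunct2, THEN conjunct2, THEN conjunct1, rule_format, OF that] by simp_all
  have gg: "set (concat (g i j)) \<inter> set (concat (g i j')) = {}" if "i < w" "j < \<mu>" "j' < \<mu>" "j \<noteq> j'" for i j j'
    using kg[THEN conjunct2, THEN conjunct2, THEN conjunct2, THEN conjunct1, rule_format, OF that(1)] that(2-) by blast
  have cover: "set (k i) \<union> (\<Union>j<\<mu>. set (concat (g i j))) = {..<v}" if "i < w" for i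
    using kg[OF that] by (elim conjE)
  have H_eq: "H i = cycle_edges (k i) \<union> (\<Union>j<\<mu>. \<Union>c\<in>set (g i j). cycle_edges c)" if "i < w" for i
    using kg[OF that] by (elim conjE)
  \<comment> \<open>There is one colour for each copy in each factor, and \<open>m\<close> is chosen
    to make \<open>v + m\<close> the target order.\<close>
  define n where "n = w * \<mu>"
  define m where "m = 2 * w * (\<mu> - 1)"
  have vm: "v + m = 2 * w * \<mu> + \<epsilon>"
  proof -
    have "\<mu> = Suc (\<mu> - 1)" using \<mu> by simp
    then have "2 * w * \<mu> = 2 * w + m" unfolding m_def by (metis mult_Suc_right)
    then show ?thesis by (simp add: v_def)
  qed
  define X where "X i j = {..<v} - set (concat (g i j))" for i j
  define Pa where "Pa i j = insert (start_path (k i) j) ((\<lambda>a. [a]) ` (X i j - set (start_path (k i) j)))" for i j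
  define B where "B i j = (\<Union>c\<in>set (g i j). cycle_edges c) \<union> forest_edges (Pa i j)" for i j
  define G where "G c = g (c div \<mu>) (c mod \<mu>)" for c
  define P where "P c = Pa (c div \<mu>) (c mod \<mu>)" for c
  have idx: "c div \<mu> < w" "c mod \<mu> < \<mu>" if "c < n" for c
    using that \<mu> by (auto simp: n_def less_mult_imp_div_less)
  have kX: "set (k i) \<subseteq> X i j" if "i < w" "j < \<mu>" for i j
    using cover[OF that(1)] g(4)[OF that] unfolding X_def by blast
  have finX: "finite (X i j)" for i j by (simp add: X_def)
  have startX: "set (start_path (k i) j) \<subseteq> X i j" if "i < w" "j < \<mu>" for i j
    using start_path(3)[OF k(2,3)] that kX by blast
  have forest: "linear_forest (X i j) (Pa i j)" "forest_edges (Pa i j) = path_edges (start_path (k i) j)"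
    "card (Pa i j) \<le> card (X i j)"
    "free_ends (Pa i j) a = (if a \<in> set (start_path (k i) j)
      then of_bool (hd (start_path (k i) j) = a) + of_bool (last (start_path (k i) j) = a)
      else if a \<in> X i j then 2 else 0)" if ij: "i < w" "j < \<mu>" for i j a
    unfolding Pa_def
    by (rule linear_forest_path_and_points[OF finX start_path(1,2)[OF k(2,3)[OF ij(1)]] startX[OF ij]])+
  have B_eq: "B i j = (\<Union>c\<in>set (g i j). cycle_edges c) \<union> path_edges (start_path (k i) j)" if "i < w" "j < \<mu>" for i j
    unfolding B_def using forest(2)[OF that] by simp
  have B_un: "(\<Union>j<\<mu>. B i j) = H i" if "i < w" for i
    using start_path_edges(1)[OF k(2,3)[OF that] \<mu>] B_eq[OF that] H_eq[OF that] by auto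
  \<comment> \<open>Small cycles of different copies have disjoint vertex sets, also disjoint from
    the x-cycle, and edges are nonempty; the pieces of the x-cycle itself are edge-disjoint by
    \<open>start_path_edges\<close>.\<close>
  have B_dis: "B i j \<inter> B i j' = {}" if ij: "i < w" "j < \<mu>" "j' < \<mu>" "j \<noteq> j'" for i j j'
  proof -
    have E: "e \<subseteq> set (k i)" if "e \<in> path_edges (start_path (k i) j)" for e j
      using path_edges_subset[OF that] start_path(3)[OF k(2,3)[OF ij(1)]] by blast
    have CC: "(\<Union>c\<in>set (g i j). cycle_edges c) \<inter> (\<Union>c\<in>set (g i j'). cycle_edges c) = {}"
    proof (rule equals0I)
      fix e assume e: "e \<in> (\<Union>c\<in>set (g i j). cycle_edges c) \<inter> (\<Union>c\<in>set (g i j'). cycle_edges c)"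
      show False
        using union_cycle_edges_subset[OF IntD1[OF e]] union_cycle_edges_subset(1)[OF IntD2[OF e]] gg[OF ij] by blast
    qed
    have CE: "(\<Union>c\<in>set (g i l). cycle_edges c) \<inter> path_edges (start_path (k i) l') = {}" if l: "l < \<mu>" for l l'
    proof (rule equals0I)
      fix e assume e: "e \<in> (\<Union>c\<in>set (g i l). cycle_edges c) \<inter> path_edges (start_path (k i) l')"
      show False
        using union_cycle_edges_subset[OF IntD1[OF e]] E[OF IntD2[OF e]] g(4)[OF ij(1) l] by blast
    qed
    have EE: "path_edges (start_path (k i) j) \<inter> path_edges (start_path (k i) j') = {}"
      using start_path_edges(2)[OF k(2,3)[OF ij(1)] \<mu> ij(4)] .
    have union: "(S \<union> T) \<inter> (S' \<union> T') = {}" if "S \<inter> S' = {}" "S \<inter> T' = {}" "S' \<inter> T = {}" "T \<inter> T' = {}"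
      for S T S' T' :: "nat set set" using that by blast
    show ?thesis unfolding B_eq[OF ij(1,2)] B_eq[OF ij(1,3)]
      by (rule union[OF CC CE[OF ij(2)] CE[OF ij(3)] EE])
  qed
  have H_dis: "H i \<inter> H i' = {}" if "i < w" "i' < w" "i \<noteq> i'" for i i'
  proof -
    have "H i \<noteq> H i'" using H that by (auto simp: bij_betw_def inj_on_def)
    then show ?thesis using D(1) H_D that by blast
  qed
  have H_I: "H i \<inter> I = {}" if "i < w" for i using D(2) H_D[OF that] by blast
  have col: "colour_class n G P I c = (if c < n then B (c div \<mu>) (c mod \<mu>) else I)" for c
    by (simp add: colour_class_def B_def G_def P_def)
  have BH: "B (c div \<mu>) (c mod \<mu>) \<subseteq> H (c div \<mu>)" if "c < n" for c
    using B_un idx[OF that] by blast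
  have dis: "disjoint_family_on (colour_class n G P I) {..n}"
    unfolding disjoint_family_on_def col
  proof (intro ballI impI)
    fix c c' assume c: "c \<in> {..n}" "c' \<in> {..n}" "c \<noteq> c'"
    consider "c = n" "c' < n" | "c < n" "c' = n" | "c < n" "c' < n" "c div \<mu> \<noteq> c' div \<mu>" | "c < n" "c' < n" "c div \<mu> = c' div \<mu>"
      using c by force
    then show "(if c < n then B (c div \<mu>) (c mod \<mu>) else I) \<inter> (if c' < n then B (c' div \<mu>) (c' mod \<mu>) else I) = {}"
    proof cases
      case 1
      then show ?thesis using BH[of c'] H_I[OF idx(1)[of c']] by auto
    next
      case 2
      then show ?thesis using BH[of c] H_I[OF idx(1)[of c]] by auto
    next
      case 3
      then have "H (c div \<mu>) \<inter> H (c' div \<mu>) = {}" using H_dis idx by blast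
      then show ?thesis using 3 BH[of c] BH[of c'] by auto
    next
      case 4
      then have "c mod \<mu> \<noteq> c' mod \<mu>" using c(3) by (metis div_mod_decomp)
      then show ?thesis using 4 B_dis[of "c div \<mu>" "c mod \<mu>" "c' mod \<mu>"] idx[of c] idx[of c'] by auto
    qed
  qed
  have un: "(\<Union>c\<le>n. colour_class n G P I c) = complete_edges v"
  proof -
    have "(\<Union>c<n. B (c div \<mu>) (c mod \<mu>)) = (\<Union>i<w. \<Union>j<\<mu>. B i j)"
    proof (intro equalityI subsetI)
      fix e assume "e \<in> (\<Union>i<w. \<Union>j<\<mu>. B i j)"
      then obtain i j where ij: "i < w" "j < \<mu>" "e \<in> B i j" by blast
      have "i * \<mu> + j < n" unfolding n_def using ij by (intro mult_add_less)
      moreover have "(i * \<mu> + j) div \<mu> = i" "(i * \<mu> + j) mod \<mu> = j" using ij by auto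
      ultimately show "e \<in> (\<Union>c<n. B (c div \<mu>) (c mod \<mu>))" using ij(3) by (intro UN_I[of "i * \<mu> + j"]) auto
    qed (use idx in blast)
    also have "\<dots> = (\<Union>i<w. H i)" using B_un by auto
    also have "\<dots> = \<Union>D" using H by (auto simp: bij_betw_def atLeast0LessThan)
    finally have "(\<Union>c<n. B (c div \<mu>) (c mod \<mu>)) = complete_edges v - I" using D(2) by simp
    moreover have "(\<Union>c\<le>n. colour_class n G P I c) = (\<Union>c<n. B (c div \<mu>) (c mod \<mu>)) \<union> I"
      unfolding lessThan_Suc_atMost[symmetric] lessThan_Suc col by auto
    moreover have "I \<subseteq> complete_edges v" using I by (auto simp: one_factor_def split: if_splits)
    ultimately show ?thesis by auto
  qed
  \<comment> \<open>A forest has at most \<open>v - sum_list ls\<close> paths. As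
    \<open>sum_list ls\<close> exceeds \<epsilon>, this is less than \<open>2 * w\<close>, hence at
    most \<open>m\<close>.\<close>
  have len_ge: "sum_list ls \<ge> 3"
  proof -
    obtain l where "l \<in> set ls" using assms(2,4) by (cases ls) auto
    then show ?thesis using assms(5) member_le_sum_list[of l ls] by force
  qed
  have "\<mu> - 1 \<ge> 1" using \<mu> by simp
  then have m_ge: "m \<ge> 2 * w" unfolding m_def by (metis mult.right_neutral mult_le_mono2)
  have card_g: "card (set (concat (g i j))) = sum_list ls" if "i < w" "j < \<mu>" for i j
  proof -
    have "card (set (concat (g i j))) = length (concat (g i j))" using g(3)[OF that] by (rule distinct_card)
    also have "\<dots> = sum_list ls" using g(1)[OF that] by (metis length_concat sum_mset_sum_list)
    finally show ?thesis .
  qed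
  have g_sub: "set (concat (g i j)) \<subseteq> {..<v}" if "i < w" "j < \<mu>" for i j using cover that by blast
  \<comment> \<open>Each factor contributes \<open>2 * (\<mu> - 1)\<close> ends at \<open>a\<close>.
    Off the x-cycle, \<open>a\<close> lies in exactly one copy \<open>j0\<close>, with no end in
    that colour, and is isolated in the forests of all the others.\<close>
  have ends: "(\<Sum>c<n. free_ends (P c) a) = m" if a: "a < v" for a
  proof -
    have "(\<Sum>j<\<mu>. free_ends (Pa i j) a) = 2 * (\<mu> - 1)" if i: "i < w" for i
    proof (cases "a \<in> set (k i)")
      case True
      have "(\<Sum>j<\<mu>. free_ends (Pa i j) a) = (\<Sum>j<\<mu>. if a \<in> set (start_path (k i) j)
          then of_bool (hd (start_path (k i) j) = a) + of_bool (last (start_path (k i) j) = a) else 2)"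
        using forest(4)[OF i] kX[OF i] True by (intro sum.cong) auto
      then show ?thesis using sum_start_free_ends[OF k(2,3)[OF i] \<mu> True] by simp
    next
      case False
      then obtain j0 where j0: "j0 < \<mu>" "a \<in> set (concat (g i j0))" using cover[OF i] a by blast
      have fe: "free_ends (Pa i j) a = (if j = j0 then 0 else 2)" if j: "j < \<mu>" for j
      proof -
        have "a \<notin> set (start_path (k i) j)" using False start_path(3)[OF k(2,3)[OF i]] by blast
        moreover have "a \<in> X i j \<longleftrightarrow> j \<noteq> j0" using gg[OF i j j0(1)] j0 a unfolding X_def by blast
        ultimately show ?thesis using forest(4)[OF i j] by simp
      qed
      have "(\<Sum>j<\<mu>. free_ends (Pa i j) a) = (\<Sum>j\<in>{..<\<mu>} - {j0}. 2)"
        using fe j0(1) by (subst sum.remove[of _ j0]) auto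
      then show ?thesis using j0(1) by simp
    qed
    then have "(\<Sum>i<w. \<Sum>j<\<mu>. free_ends (Pa i j) a) = w * (2 * (\<mu> - 1))" by simp
    then show ?thesis unfolding P_def n_def m_def using sum_div_mod[of \<mu> "\<lambda>i j. free_ends (Pa i j) a" w] \<mu> by simp
  qed
  have sol: "partial_solution (even v) n G v m P I {}"
    unfolding partial_solution_def
  proof (intro conjI allI impI)
    show "v + m = 2 * n + 1 + of_bool (even v)" unfolding vm using assms(7) ev by (auto simp: n_def)
    show "disjoint_family_on (colour_class n G P I) {..n}" by (rule dis)
    show "(\<Union>c\<le>n. colour_class n G P I c) = complete_edges v" by (rule un)
    \<comment> \<open>The given 1-factor covers every vertex, so none is uncovered at the start, and
      \<open>m\<close> is even as the parity condition demands.\<close>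
    show "partial_matching (even v) v m I {}"
      unfolding partial_matching_def using I by (cases "even v") (simp_all add: one_factor_def m_def)
    show "(\<Sum>c<n. free_ends (P c) a) + of_bool (a \<in> {}) = m" if "a < v" for a using ends[OF that] by simp
    fix c assume "c < n"
    note ij = idx[OF this]
    show "set (concat (G c)) \<subseteq> {..<v}" unfolding G_def by (rule g_sub[OF ij])
    show "linear_forest ({..<v} - set (concat (G c))) (P c)"
      unfolding G_def P_def X_def[symmetric] by (rule forest(1)[OF ij])
    show "P c \<noteq> {}" by (simp add: P_def Pa_def)
    have "card (P c) \<le> card (X (c div \<mu>) (c mod \<mu>))" unfolding P_def by (rule forest(3)[OF ij])
    also have "\<dots> = v - sum_list ls" unfolding X_def using g_sub[OF ij] card_g[OF ij] by (simp add: card_Diff_subset del: set_concat)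
    also have "\<dots> \<le> m" using len_ge m_ge assms(7) by (auto simp: v_def)
    finally show "card (P c) \<le> m" .
  qed
  have m1: "m \<ge> 1" using m_ge assms(6) by linarith
  have ls_v: "sum_mset (mset ls) \<le> v"
  proof -
    have "sum_list ls \<le> \<mu> * sum_list ls" using \<mu> by simp
    then show ?thesis unfolding v_def sum_mset_sum_list using assms(8) by linarith
  qed
  have parts: "mset (map length (G c)) = mset ls \<and> (\<forall>k\<in>set (G c). length k \<ge> 3) \<and> distinct (concat (G c))"
    if "c < n" for c unfolding G_def using g[OF idx[OF that]] by blast
  have "OP_solvable ({#v + m - sum_mset (mset ls)#} + mset ls)"
    by (rule partial_solution_imp_OP_solvable[OF sol m1 parts ls_v])
  then show ?thesis by (simp add: vm sum_mset_sum_list)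
qed

end
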